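(* Let $\varepsilon>0$, let $f_+,f_-:\mathbb R\to\mathbb R$ be the boundary functions, and let there exist a point $C=(C_1,C_2)\in\Omega_\varepsilon$ such that one can construct: - a left herringbone $\Omega^{\mathrm{HB}}_\varepsilon(C+\varepsilon,C^r)$, and - a right herringbone $\Omega^{\mathrm{HB}}_\varepsilon(\bar C-\varepsilon,C^l)$. Then, if in the rectangle between them, with vertices at the points $(C_1+C_2,\varepsilon)$, $C+\varepsilon$, $(C_1-C_2,-\varepsilon)$ and $\bar C-\varepsilon$, one defines a bilinear function (which is uniquely determined by its boundary values), one obtains a diagonally concave $C^1$-smooth function.
   Context: Notation. $\Omega_\varepsilon=\{(x_1,x_2):|x_2|\le\varepsilon\}$. For $x=(x_1,x_2)$ put $\bar x=(x_1,-x_2)$ and, for a number $a$, $x+a=(x_1+a,x_2)$. The functions $f_\pm$ are smooth enough for the derivatives below to make sense. A function on a subset of the strip is diagonally concave if it is concave on every segment contained in the subset and parallel to $(1,1)$ or to $(1,-1)$. Bilinear function and the resulting function. A bilinear function here is a function of the form $a(x_1^2-x_2^2)+bx_1+cx_2+d$. Its values at the vertices $(C_1+C_2,\varepsilon)$ and $(C_1-C_2,-\varepsilon)$ are $f_+(C_1+C_2)$ and $f_-(C_1-C_2)$, and its values at the vertices $C+\varepsilon$ and $\bar C-\varepsilon$ are those of the left and of the right herringbone candidate, respectively. The function obtained equals the left herringbone candidate on $\Omega^{\mathrm{HB}}_\varepsilon(C+\varepsilon,C^r)$, the right herringbone candidate on $\Omega^{\mathrm{HB}}_\varepsilon(\bar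 C-\varepsilon,C^l)$, and the bilinear function on the rectangle; the conclusion concerns this function on the union of the three sets. Herringbones. A spine is a graph $\{(u,T(u)):u\in[p,q]\}$ with $T$ continuous on $[p,q]$, and $C^1$ with $|T|<\varepsilon$, $|T'|<1$ on $(p,q)$. $\Omega^{\mathrm{HB}}_\varepsilon(P,Q)$ denotes the domain of a herringbone whose spine goes from the point $P$ to the point $Q$. Here $C^r\in\Omega_\varepsilon$ is some point to the right of $C+\varepsilon$, and $C^l\in\Omega_\varepsilon$ is some point to the left of $\bar C-\varepsilon$. Left herringbone: from each spine point $(u,T)$, $T=T(u)$, two segments (ribs) go to the left, one to $(u+T-\varepsilon,\varepsilon)$, the other to $(u-T-\varepsilon,-\varepsilon)$; the domain is the union of all ribs. The curve $\{(u-\varepsilon,T(u))\}$ is an integral curve of the field $$\dot x_1=\varepsilon(f_+'-f_-')-x_2(\varepsilon-x_2)f_-''-x_2(\varepsilon+x_2)f_+'',\qquad \dot x_2=x_2(f_-'-f_+')-x_2(\varepsilon-x_2)f_-''+x_2(\varepsilon+x_2)f_+'',$$ with derivatives of $f_+$ at $x_1+x_2$ and of $f_-$ at $x_1-x_2$. A left herringbone candidate is a $C^1$-smooth diagonally concave function $B$ on the domain with $B(x_1,\pm\varepsilon)=f_\pm(x_1)$, affine on each rib, whose value at the spine point $(u,T)$ is $$\frac{\varepsilon^2-T^2}{2\varepsilon T}\big[(\varepsilon+T)f_+'-(\varepsilon-T)f_-'\big]+\frac{(\varepsilon+T)f_++(\varepsilon-T)f_-}{2\varepsilon},$$ with $f_+,f_+'$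 at $u+T-\varepsilon$ and $f_-,f_-'$ at $u-T-\varepsilon$ (by continuity along the spine where $T=0$). Right herringbone: the ribs from $(u,T)$ go to the right, to $(u-T+\varepsilon,\varepsilon)$ and to $(u+T+\varepsilon,-\varepsilon)$; the domain is the union of all ribs. The curve $\{(u+\varepsilon,T(u))\}$ is an integral curve of the field $$\dot x_1=\varepsilon(f_-'-f_+')-x_2(\varepsilon+x_2)f_+''-x_2(\varepsilon-x_2)f_-'',\qquad \dot x_2=x_2(f_-'-f_+')-x_2(\varepsilon+x_2)f_+''+x_2(\varepsilon-x_2)f_-'',$$ with derivatives of $f_+$ at $x_1-x_2$ and of $f_-$ at $x_1+x_2$. A right herringbone candidate is a $C^1$-smooth diagonally concave function $B$ on the domain with $B(x_1,\pm\varepsilon)=f_\pm(x_1)$, affine on each rib, whose value at the spine point $(u,T)$ is $$\frac{\varepsilon^2-T^2}{2\varepsilon T}\big[(\varepsilon-T)f_-'-(\varepsilon+T)f_+'\big]+\frac{(\varepsilon+T)f_++(\varepsilon-T)f_-}{2\varepsilon},$$ with $f_+,f_+'$ at $u-T+\varepsilon$ and $f_-,f_-'$ at $u+T+\varepsilon$ (by continuity along the spine where $T=0$). "One can construct" a left (respectively, right) herringbone $\Omega^{\mathrm{HB}}_\varepsilon(P,Q)$ means that there exist (and are fixed) a spine going from $P$ to $Q$ with the integral-curve property stated above for left (respectively, right) herringbones, and a left (respectively, right) herringbone candidate on the domain formed by the ribs of this spine. *)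

theory Defs
  imports "HOL-Analysis.Analysis"
begin

definition strip :: "real \<Rightarrow> (real \<times> real) set" where
  "strip \<epsilon> = {x. \<bar>snd x\<bar> \<le> \<epsilon>}"

definition C2_smooth :: "(real \<Rightarrow> real) \<Rightarrow> bool" where
  "C2_smooth f \<longleftrightarrow> f C1_differentiable_on UNIV \<and> deriv f C1_differentiable_on UNIV"

text \<open>\<open>C\<^sup>1\<close>-smoothness on a set that need not be open: the derivative is taken within the
  set, up to its boundary, and the gradient \<open>G\<close> is continuous on the whole set.\<close>

definition C1_smooth_on :: "(real \<times> real) set \<Rightarrow> (real \<times> real \<Rightarrow> real) \<Rightarrow> bool" where
  "C1_smooth_on S B \<longleftrightarrow>
     (\<exists>G. continuous_on S G \<and> (\<forall>x\<in>S. (B has_derivative (\<lambda>h. G x \<bullet> h)) (at x within S)))"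

definition diag_concave_on :: "(real \<times> real) set \<Rightarrow> (real \<times> real \<Rightarrow> real) \<Rightarrow> bool" where
  "diag_concave_on S B \<longleftrightarrow>
     (\<forall>x y. closed_segment x y \<subseteq> S \<and> (\<exists>t. y - x = t *\<^sub>R (1, 1) \<or> y - x = t *\<^sub>R (1, -1))
        \<longrightarrow> concave_on (closed_segment x y) B)"

definition affine_on_segment ::
  "real \<times> real \<Rightarrow> real \<times> real \<Rightarrow> (real \<times> real \<Rightarrow> real) \<Rightarrow> bool" where
  "affine_on_segment a b B \<longleftrightarrow>
     (\<forall>t\<in>{0..1}. B ((1 - t) *\<^sub>R a + t *\<^sub>R b) = (1 - t) * B a + t * B b)"

definition spine :: "real \<Rightarrow> (real \<Rightarrow> real) \<Rightarrow> real \<Rightarrow> real \<Rightarrow> bool" where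
  "spine \<epsilon> T p q \<longleftrightarrow>
     p < q \<and> continuous_on {p..q} T \<and> T C1_differentiable_on {p<..<q} \<and>
     (\<forall>u\<in>{p<..<q}. \<bar>T u\<bar> < \<epsilon> \<and> \<bar>deriv T u\<bar> < 1)"


definition trajectory ::
  "(real \<times> real \<Rightarrow> real \<times> real) \<Rightarrow> (real \<times> real) set \<Rightarrow> bool" where
  "trajectory X \<Gamma> \<longleftrightarrow>
     (\<exists>\<gamma> a b. a \<le> b \<and> (\<forall>t\<in>{a..b}. (\<gamma> has_vector_derivative X (\<gamma> t)) (at t within {a..b})) \<and>
        \<gamma> ` {a..b} = \<Gamma>)"

text \<open>The curve \<open>c\<close> over \<open>[p, q]\<close> is an integral curve of \<open>X\<close> issuing from the end \<open>c s\<close>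
  (\<open>s = p\<close> or \<open>s = q\<close>). For \<open>S = {}\<close> this says that the curve is the trace of a solution of
  \<open>x' = X x\<close>. A nonempty \<open>S\<close> admits curves which, after leaving \<open>c s\<close>, run through or end in
  finitely many equilibria of \<open>X\<close>. This matters because the fields below vanish at the points
  \<open>x\<^sub>2 = 0\<close> with \<open>f\<^sub>+' = f\<^sub>-'\<close>, and these are the only points of the axis where the spine value
  can be finite. As an integral curve does not issue from an equilibrium, \<open>s\<close> is not in \<open>S\<close>.\<close>

definition integral_curve_from ::
  "(real \<times> real \<Rightarrow> real \<times> real) \<Rightarrow> (real \<Rightarrow> real \<times> real) \<Rightarrow> real \<Rightarrow> real \<Rightarrow> real \<Rightarrow> bool" where
  "integral_curve_from X c p q s \<longleftrightarrow>
     (\<exists>S. finite S \<and> S \<subseteq> {p..q} \<and> s \<notin> S \<and> (\<forall>u\<in>S. X (c u) = 0) \<and>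
        (\<forall>a b. p \<le> a \<and> a \<le> b \<and> b \<le> q \<and> {a..b} \<inter> S = {} \<longrightarrow> trajectory X (c ` {a..b})))"

text \<open>The arguments \<open>tp\<close> and \<open>bt\<close> give the ends of the two ribs starting at the spine point
  \<open>(u, T u)\<close>.\<close>

definition herringbone_domain ::
  "(real \<Rightarrow> real) \<Rightarrow> (real \<Rightarrow> real \<times> real) \<Rightarrow> (real \<Rightarrow> real \<times> real) \<Rightarrow> real \<Rightarrow> real
     \<Rightarrow> (real \<times> real) set" where
  "herringbone_domain T tp bt p q =
     (\<Union>u\<in>{p..q}. closed_segment (u, T u) (tp u) \<union> closed_segment (u, T u) (bt u))"

text \<open>The prescribed spine values \<open>V u t\<close> contain a division by \<open>t\<close>. At the spine points with
  \<open>T u = 0\<close> the value is the limit of \<open>V\<close> along the spine points with \<open>T v \<noteq> 0\<close>. The condition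
  \<open>islimpt\<close> ensures that there are such points arbitrarily close to \<open>u\<close>, so that the limit is
  not taken along a trivial filter.\<close>

definition herringbone_candidate ::
  "real \<Rightarrow> (real \<Rightarrow> real) \<Rightarrow> (real \<Rightarrow> real) \<Rightarrow> (real \<Rightarrow> real) \<Rightarrow> (real \<Rightarrow> real \<times> real)
     \<Rightarrow> (real \<Rightarrow> real \<times> real) \<Rightarrow> (real \<Rightarrow> real \<Rightarrow> real) \<Rightarrow> real \<Rightarrow> real \<Rightarrow> (real \<times> real \<Rightarrow> real) \<Rightarrow> bool"
  where
  "herringbone_candidate \<epsilon> fp fm T tp bt V p q B \<longleftrightarrow>
     (let D = herringbone_domain T tp bt p q; Z = {v\<in>{p..q}. T v \<noteq> 0} in
        C1_smooth_on D B \<and> diag_concave_on D B \<and>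
        (\<forall>x\<^sub>1. (x\<^sub>1, \<epsilon>) \<in> D \<longrightarrow> B (x\<^sub>1, \<epsilon>) = fp x\<^sub>1) \<and>
        (\<forall>x\<^sub>1. (x\<^sub>1, -\<epsilon>) \<in> D \<longrightarrow> B (x\<^sub>1, -\<epsilon>) = fm x\<^sub>1) \<and>
        (\<forall>u\<in>{p..q}. affine_on_segment (u, T u) (tp u) B \<and> affine_on_segment (u, T u) (bt u) B) \<and>
        (\<forall>u\<in>{p..q}. T u \<noteq> 0 \<longrightarrow> B (u, T u) = V u (T u)) \<and>
        (\<forall>u\<in>{p..q}. T u = 0 \<longrightarrow>
           u islimpt Z \<and> ((\<lambda>v. V v (T v)) \<longlongrightarrow> B (u, T u)) (at u within Z)))"


definition left_top :: "real \<Rightarrow> (real \<Rightarrow> real) \<Rightarrow> real \<Rightarrow> real \<times> real" where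
  "left_top \<epsilon> T u = (u + T u - \<epsilon>, \<epsilon>)"

definition left_bot :: "real \<Rightarrow> (real \<Rightarrow> real) \<Rightarrow> real \<Rightarrow> real \<times> real" where
  "left_bot \<epsilon> T u = (u - T u - \<epsilon>, -\<epsilon>)"

definition left_domain :: "real \<Rightarrow> (real \<Rightarrow> real) \<Rightarrow> real \<Rightarrow> real \<Rightarrow> (real \<times> real) set" where
  "left_domain \<epsilon> T p q = herringbone_domain T (left_top \<epsilon> T) (left_bot \<epsilon> T) p q"

definition left_field ::
  "real \<Rightarrow> (real \<Rightarrow> real) \<Rightarrow> (real \<Rightarrow> real) \<Rightarrow> real \<times> real \<Rightarrow> real \<times> real" where
  "left_field \<epsilon> fp fm = (\<lambda>(x\<^sub>1, x\<^sub>2).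
     (\<epsilon> * (deriv fp (x\<^sub>1 + x\<^sub>2) - deriv fm (x\<^sub>1 - x\<^sub>2))
        - x\<^sub>2 * (\<epsilon> - x\<^sub>2) * deriv (deriv fm) (x\<^sub>1 - x\<^sub>2)
        - x\<^sub>2 * (\<epsilon> + x\<^sub>2) * deriv (deriv fp) (x\<^sub>1 + x\<^sub>2),
      x\<^sub>2 * (deriv fm (x\<^sub>1 - x\<^sub>2) - deriv fp (x\<^sub>1 + x\<^sub>2))
        - x\<^sub>2 * (\<epsilon> - x\<^sub>2) * deriv (deriv fm) (x\<^sub>1 - x\<^sub>2)
        + x\<^sub>2 * (\<epsilon> + x\<^sub>2) * deriv (deriv fp) (x\<^sub>1 + x\<^sub>2)))"

definition left_spine_value ::
  "real \<Rightarrow> (real \<Rightarrow> real) \<Rightarrow> (real \<Rightarrow> real) \<Rightarrow> real \<Rightarrow> real \<Rightarrow> real" where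
  "left_spine_value \<epsilon> fp fm u t =
     (\<epsilon>\<^sup>2 - t\<^sup>2) / (2 * \<epsilon> * t)
        * ((\<epsilon> + t) * deriv fp (u + t - \<epsilon>) - (\<epsilon> - t) * deriv fm (u - t - \<epsilon>))
     + ((\<epsilon> + t) * fp (u + t - \<epsilon>) + (\<epsilon> - t) * fm (u - t - \<epsilon>)) / (2 * \<epsilon>)"

definition left_herringbone ::
  "real \<Rightarrow> (real \<Rightarrow> real) \<Rightarrow> (real \<Rightarrow> real) \<Rightarrow> real \<times> real \<Rightarrow> real \<times> real
     \<Rightarrow> (real \<Rightarrow> real) \<Rightarrow> (real \<times> real \<Rightarrow> real) \<Rightarrow> bool" where
  "left_herringbone \<epsilon> fp fm P Q T B \<longleftrightarrow>
     spine \<epsilon> T (fst P) (fst Q) \<and> T (fst P) = snd P \<and> T (fst Q) = snd Q \<and>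
     integral_curve_from (left_field \<epsilon> fp fm) (\<lambda>u. (u - \<epsilon>, T u)) (fst P) (fst Q) (fst P) \<and>
     herringbone_candidate \<epsilon> fp fm T (left_top \<epsilon> T) (left_bot \<epsilon> T)
       (left_spine_value \<epsilon> fp fm) (fst P) (fst Q) B"


definition right_top :: "real \<Rightarrow> (real \<Rightarrow> real) \<Rightarrow> real \<Rightarrow> real \<times> real" where
  "right_top \<epsilon> T u = (u - T u + \<epsilon>, \<epsilon>)"

definition right_bot :: "real \<Rightarrow> (real \<Rightarrow> real) \<Rightarrow> real \<Rightarrow> real \<times> real" where
  "right_bot \<epsilon> T u = (u + T u + \<epsilon>, -\<epsilon>)"

definition right_domain :: "real \<Rightarrow> (real \<Rightarrow> real) \<Rightarrow> real \<Rightarrow> real \<Rightarrow> (real \<times> real) set" where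
  "right_domain \<epsilon> T p q = herringbone_domain T (right_top \<epsilon> T) (right_bot \<epsilon> T) p q"

definition right_field ::
  "real \<Rightarrow> (real \<Rightarrow> real) \<Rightarrow> (real \<Rightarrow> real) \<Rightarrow> real \<times> real \<Rightarrow> real \<times> real" where
  "right_field \<epsilon> fp fm = (\<lambda>(x\<^sub>1, x\<^sub>2).
     (\<epsilon> * (deriv fm (x\<^sub>1 + x\<^sub>2) - deriv fp (x\<^sub>1 - x\<^sub>2))
        - x\<^sub>2 * (\<epsilon> + x\<^sub>2) * deriv (deriv fp) (x\<^sub>1 - x\<^sub>2)
        - x\<^sub>2 * (\<epsilon> - x\<^sub>2) * deriv (deriv fm) (x\<^sub>1 + x\<^sub>2),
      x\<^sub>2 * (deriv fm (x\<^sub>1 + x\<^sub>2) - deriv fp (x\<^sub>1 - x\<^sub>2))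
        - x\<^sub>2 * (\<epsilon> + x\<^sub>2) * deriv (deriv fp) (x\<^sub>1 - x\<^sub>2)
        + x\<^sub>2 * (\<epsilon> - x\<^sub>2) * deriv (deriv fm) (x\<^sub>1 + x\<^sub>2)))"

definition right_spine_value ::
  "real \<Rightarrow> (real \<Rightarrow> real) \<Rightarrow> (real \<Rightarrow> real) \<Rightarrow> real \<Rightarrow> real \<Rightarrow> real" where
  "right_spine_value \<epsilon> fp fm u t =
     (\<epsilon>\<^sup>2 - t\<^sup>2) / (2 * \<epsilon> * t)
        * ((\<epsilon> - t) * deriv fm (u + t + \<epsilon>) - (\<epsilon> + t) * deriv fp (u - t + \<epsilon>))
     + ((\<epsilon> + t) * fp (u - t + \<epsilon>) + (\<epsilon> - t) * fm (u + t + \<epsilon>)) / (2 * \<epsilon>)"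

text \<open>The spine of a right herringbone goes leftwards from \<open>P\<close> to \<open>Q\<close>, so it is a graph over
  \<open>{fst Q..fst P}\<close>.\<close>

definition right_herringbone ::
  "real \<Rightarrow> (real \<Rightarrow> real) \<Rightarrow> (real \<Rightarrow> real) \<Rightarrow> real \<times> real \<Rightarrow> real \<times> real
     \<Rightarrow> (real \<Rightarrow> real) \<Rightarrow> (real \<times> real \<Rightarrow> real) \<Rightarrow> bool" where
  "right_herringbone \<epsilon> fp fm P Q T B \<longleftrightarrow>
     spine \<epsilon> T (fst Q) (fst P) \<and> T (fst P) = snd P \<and> T (fst Q) = snd Q \<and>
     integral_curve_from (right_field \<epsilon> fp fm) (\<lambda>u. (u + \<epsilon>, T u)) (fst Q) (fst P) (fst P) \<and>
     herringbone_candidate \<epsilon> fp fm T (right_top \<epsilon> T) (right_bot \<epsilon> T)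
       (right_spine_value \<epsilon> fp fm) (fst Q) (fst P) B"


text \<open>Bilinear in the coordinates \<open>x\<^sub>1 + x\<^sub>2\<close> and \<open>x\<^sub>1 - x\<^sub>2\<close>; not the library notion \<open>bilinear\<close>.\<close>

definition bilinear_function :: "(real \<times> real \<Rightarrow> real) \<Rightarrow> bool" where
  "bilinear_function g \<longleftrightarrow>
     (\<exists>a b c d. \<forall>x\<^sub>1 x\<^sub>2. g (x\<^sub>1, x\<^sub>2) = a * (x\<^sub>1\<^sup>2 - x\<^sub>2\<^sup>2) + b * x\<^sub>1 + c * x\<^sub>2 + d)"

definition middle_rectangle :: "real \<Rightarrow> real \<Rightarrow> real \<Rightarrow> (real \<times> real) set" where
  "middle_rectangle \<epsilon> C1 C2 =
     convex hull {(C1 + C2, \<epsilon>), (C1 + \<epsilon>, C2), (C1 - C2, -\<epsilon>), (C1 - \<epsilon>, -C2)}"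

definition rectangle_function ::
  "real \<Rightarrow> (real \<Rightarrow> real) \<Rightarrow> (real \<Rightarrow> real) \<Rightarrow> real \<Rightarrow> real \<Rightarrow> (real \<times> real \<Rightarrow> real)
     \<Rightarrow> (real \<times> real \<Rightarrow> real) \<Rightarrow> (real \<times> real \<Rightarrow> real) \<Rightarrow> bool" where
  "rectangle_function \<epsilon> fp fm C1 C2 Bl Br g \<longleftrightarrow>
     bilinear_function g \<and>
     g (C1 + C2, \<epsilon>) = fp (C1 + C2) \<and> g (C1 - C2, -\<epsilon>) = fm (C1 - C2) \<and>
     g (C1 + \<epsilon>, C2) = Bl (C1 + \<epsilon>, C2) \<and> g (C1 - \<epsilon>, -C2) = Br (C1 - \<epsilon>, -C2)"

end

theory Submission
  imports Defs
begin

text \<open>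
  \<^bold>\<open>Smoothness.\<close> In the coordinates \<open>x\<^sub>1 + x\<^sub>2\<close> and \<open>x\<^sub>1 - x\<^sub>2\<close> the rectangle is a product of
  intervals. The left herringbone meets it in the two ribs from the start of its spine, which are the two right
  sides of the rectangle, and the right herringbone in the two left sides. On a rib both the candidate and
  the bilinear function are affine, and they agree at the ends, so they have the same values and the same
  slope along the rib. It remains to compare the transversal derivatives, for which the horizontal one is
  taken. For the bilinear function it is affine along the rib, and for the candidate too: this follows by
  differentiating the affine interpolation on the ribs with respect to the spine parameter
  (\<open>gradient_across_rib\<close>). So it is enough to compare it at the two ends. At the spine vertex the slopes
  along the two ribs determine the whole gradient. At the vertex on the boundary of the strip the candidate
  has horizontal derivative \<open>f\<^sub>+'\<close> or \<open>f\<^sub>-'\<close>, and the bilinear function has the same one because of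
  the formula for the spine values (\<open>start_value_bilin\<close>).

  \<^bold>\<open>The role of the integral curve.\<close> That formula divides by \<open>T\<close>, so it must be applied with \<open>C2 \<noteq> 0\<close>. The
  axis is invariant under the vector field of the left herringbone. A spine starting on the axis would thus run
  along it, but the spine values on the axis are limits taken along spine points off the axis
  (\<open>left_herringbone_start_off_axis\<close>).

  \<^bold>\<open>Degenerate rectangles.\<close> If \<open>\<bar>C2\<bar> = \<epsilon>\<close>, the rectangle is a diagonal segment and the vertex values do
  not determine the bilinear function outside the segment. The function chosen here has the horizontal
  derivatives \<open>f\<^sub>+'\<close> and \<open>f\<^sub>-'\<close> at the vertices on the boundary of the strip. For \<open>\<bar>C2\<bar> < \<epsilon>\<close> this is
  the only bilinear function with the required vertex values, and for \<open>\<bar>C2\<bar> = \<epsilon>\<close> it has the right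
  gradient on the segment, so both cases are treated alike.

  \<^bold>\<open>Concavity.\<close> On a diagonal line the three domains follow one another in the order right herringbone,
  rectangle, left herringbone. The function is concave on each part and differentiable at the junctions,
  hence concave (\<open>concave_on_join\<close>, \<open>diag_concave_on_glued\<close>).
\<close>

section \<open>Concave functions on intervals\<close>

lemma concave_on_cong_fun:
  assumes "concave_on S f" and "\<And>x. x \<in> S \<Longrightarrow> f x = g x"
  shows "concave_on S g"
proof -
  have "u *\<^sub>R x + v *\<^sub>R y \<in> S" if "x \<in> S" "y \<in> S" "0 \<le> u" "0 \<le> v" "u + v = 1" for x y u v
    using assms(1) that by (auto simp: concave_on_iff convex_def)
  then show ?thesis
    using assms unfolding concave_on_iff by simp
qed

text \<open>The difference quotients of \<open>\<phi>\<close> at \<open>m\<close> in the direction \<open>x - m\<close> are bounded below by that of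
  the full chord, and they tend to \<open>d * (x - m)\<close>. A derivative within \<open>S\<close> is enough, so \<open>m\<close> may be an end
  of \<open>S\<close>; this is the case in the next lemma.\<close>

lemma concave_below_tangent:
  fixes \<phi> :: "real \<Rightarrow> real"
  assumes conc: "concave_on S \<phi>" and m: "m \<in> S" and x: "x \<in> S"
    and der: "(\<phi> has_real_derivative d) (at m within S)"
  shows "\<phi> x \<le> \<phi> m + d * (x - m)"
proof -
  define h where "h r = m + r * (x - m)" for r
  have hS: "h ` {0..1} \<subseteq> S"
  proof -
    have "convex S" using conc by (simp add: concave_on_iff)
    then have "(1 - r) *\<^sub>R m + r *\<^sub>R x \<in> S" if "0 \<le> r" "r \<le> 1" for r
      using m x that by (simp add: convex_alt)
    then show ?thesis by (auto simp: h_def algebra_simps)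
  qed
  have "(\<phi> \<circ> h has_real_derivative d * (x - m)) (at 0 within {0..1})"
  proof (rule DERIV_image_chain)
    show "(h has_real_derivative x - m) (at 0 within {0..1})"
      unfolding h_def by (auto intro!: derivative_eq_intros)
    show "(\<phi> has_real_derivative d) (at (h 0) within h ` {0..1})"
      using DERIV_subset[OF der hS] by (simp add: h_def)
  qed
  then have lim: "((\<lambda>r. (\<phi> (h r) - \<phi> m) / r) \<longlongrightarrow> d * (x - m)) (at 0 within {0..1})"
    by (simp add: has_field_derivative_iff h_def o_def)
  have "at (0::real) within {0..1} \<noteq> bot"
    by (simp add: at_within_Icc_at_right)
  moreover have "\<phi> x - \<phi> m \<le> (\<phi> (h r) - \<phi> m) / r" if "r \<in> {0..1}" "r \<noteq> 0" for r
  proof -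
    have "(1 - r) * \<phi> m + r * \<phi> x \<le> \<phi> ((1 - r) *\<^sub>R m + r *\<^sub>R x)"
      using concave_onD[OF conc _ _ m x] that by simp
    then have "r * (\<phi> x - \<phi> m) \<le> \<phi> (h r) - \<phi> m"
      by (simp add: h_def algebra_simps)
    then show ?thesis using that by (simp add: field_simps)
  qed
  then have "\<forall>\<^sub>F r in at 0 within {0..1}. \<phi> x - \<phi> m \<le> (\<phi> (h r) - \<phi> m) / r"
    by (auto simp: eventually_at_filter)
  ultimately have "\<phi> x - \<phi> m \<le> d * (x - m)"
    by (intro tendsto_lowerbound[OF lim])
  then show ?thesis by simp
qed

text \<open>Two concave pieces with the same one-sided derivative at the junction form a concave function.
  This is why smoothness of the glued function implies that it is diagonally concave.\<close>

lemma concave_on_join: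
  fixes \<phi> :: "real \<Rightarrow> real"
  assumes left: "concave_on ({a..b} \<inter> {..m}) \<phi>" and right: "concave_on ({a..b} \<inter> {m..}) \<phi>"
    and der: "m \<in> {a..b} \<Longrightarrow> \<exists>d. (\<phi> has_real_derivative d) (at m within {a..b})"
  shows "concave_on {a..b} \<phi>"
proof (cases "m \<in> {a..b}")
  case False
  then consider "{a..b} \<inter> {m..} = {a..b}" | "{a..b} \<inter> {..m} = {a..b}" by force
  then show ?thesis using left right by cases (simp_all only:)
next
  case m: True
  then obtain d where d: "(\<phi> has_real_derivative d) (at m within {a..b})" using der by blast
  \<comment> \<open>Subtracting the common tangent at the junction leaves a function with maximum \<open>0\<close> there.\<close>
  define \<psi> where "\<psi> x = \<phi> x - (\<phi> m + d * (x - m))" for x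
  have neg: "\<psi> x \<le> 0" if "x \<in> {a..b}" for x
  proof -
    have "\<phi> x \<le> \<phi> m + d * (x - m)"
    proof (cases "x \<le> m")
      case True
      then show ?thesis
        using concave_below_tangent[OF left, of m x d] DERIV_subset[OF d] m that by auto
    next
      case False
      then show ?thesis
        using concave_below_tangent[OF right, of m x d] DERIV_subset[OF d] m that by auto
    qed
    then show ?thesis by (simp add: \<psi>_def)
  qed
  have scal: "\<psi> ((1 - t) * m + t * x) \<ge> t * \<psi> x" if x: "x \<in> {a..b}" and t: "0 \<le> t" "t \<le> 1" for t x
  proof -
    have "\<phi> ((1 - t) *\<^sub>R m + t *\<^sub>R x) \<ge> (1 - t) * \<phi> m + t * \<phi> x"
    proof (cases "x \<le> m")
      case True
      then show ?thesis using concave_onD[OF left t, of m x] m x by auto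
    next
      case False
      then show ?thesis using concave_onD[OF right t, of m x] m x by auto
    qed
    then show ?thesis by (simp add: \<psi>_def algebra_simps)
  qed
  have key: "\<psi> z \<ge> u * \<psi> x + v * \<psi> y"
    if xy: "x \<in> {a..b}" "y \<in> {a..b}" and uv: "0 \<le> u" "0 \<le> v" "u + v = 1"
      and cut: "x < m" "m < y" and z: "z = u * x + v * y" for x y z u v
  proof (cases "z \<le> m")
    case True
    define t where "t = (m - z) / (m - x)"
    have zx: "z - x = v * (y - x)" using uv(3) z by algebra
    have "z \<ge> x" using zx mult_nonneg_nonneg[of v "y - x"] uv cut by linarith
    then have t: "0 \<le> t" "t \<le> 1" using True cut by (auto simp: t_def divide_simps)
    have "t * (m - x) = m - z" using cut by (simp add: t_def)
    then have "z = (1 - t) * m + t * x" by (simp add: algebra_simps)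
    then have "\<psi> z \<ge> t * \<psi> x" using scal[OF xy(1) t] by simp
    moreover have "t \<le> u"
    proof -
      have yz: "m - z = u * (m - x) - v * (y - m)" using z uv(3) by algebra
      have "v * (y - m) \<ge> 0" using uv cut by simp
      then have "m - z \<le> u * (m - x)" using yz by linarith
      then show ?thesis using cut by (simp add: t_def divide_simps)
    qed
    then have "t * \<psi> x \<ge> u * \<psi> x" using neg[OF xy(1)] by (simp add: mult_right_mono_neg)
    moreover have "v * \<psi> y \<le> 0" using neg[OF xy(2)] uv by (simp add: mult_nonneg_nonpos)
    ultimately show ?thesis by linarith
  next
    case False
    define t where "t = (z - m) / (y - m)"
    have yz: "z - m = v * (y - m) - u * (m - x)" using z uv(3) by algebra
    have um: "u * (m - x) \<ge> 0" using uv cut by simp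
    have "z - m \<le> v * (y - m)" using yz um by simp
    also have "\<dots> \<le> y - m" using uv cut by (intro mult_left_le_one_le) auto
    finally have "z - m \<le> y - m" .
    then have t: "0 \<le> t" "t \<le> 1" using False cut by (auto simp: t_def divide_simps)
    have "t * (y - m) = z - m" using cut by (simp add: t_def)
    then have "z = (1 - t) * m + t * y" by (simp add: algebra_simps)
    then have "\<psi> z \<ge> t * \<psi> y" using scal[OF xy(2) t] by simp
    moreover have "t \<le> v" using yz um cut by (simp add: t_def divide_simps)
    then have "t * \<psi> y \<ge> v * \<psi> y" using neg[OF xy(2)] by (simp add: mult_right_mono_neg)
    moreover have "u * \<psi> x \<le> 0" using neg[OF xy(1)] uv by (simp add: mult_nonneg_nonpos)
    ultimately show ?thesis by linarith
  qed
  have "\<phi> (u * x + v * y) \<ge> u * \<phi> x + v * \<phi> y"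
    if xy: "x \<in> {a..b}" "y \<in> {a..b}" and uv: "0 \<le> u" "0 \<le> v" "u + v = 1" for x y u v
  proof -
    have untilt: "u * \<phi> x + v * \<phi> y \<le> \<phi> (u * x + v * y)"
      if "\<psi> (u * x + v * y) \<ge> u * \<psi> x + v * \<psi> y"
    proof -
      have "u * (\<phi> m + d * (x - m)) + v * (\<phi> m + d * (y - m)) = \<phi> m + d * (u * x + v * y - m)"
        using uv(3) by algebra
      then show ?thesis using that by (simp add: \<psi>_def right_diff_distrib)
    qed
    consider "x \<le> m" "y \<le> m" | "m \<le> x" "m \<le> y" | "x < m" "m < y" | "y < m" "m < x" by linarith
    then show ?thesis
    proof cases
      case 1
      then show ?thesis using left xy uv unfolding concave_on_iff by auto
    next
      case 2
      then show ?thesis using right xy uv unfolding concave_on_iff by auto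
    next
      case 3
      then show ?thesis using untilt key[OF xy uv] by simp
    next
      case 4
      then show ?thesis using untilt key[OF xy(2,1) uv(2,1)] uv(3) by (simp add: add.commute)
    qed
  qed
  then show ?thesis by (simp add: concave_on_iff)
qed

lemma closed_segment_line:
  fixes x v :: "'a::real_vector"
  assumes "l \<le> r"
  shows "closed_segment (x + l *\<^sub>R v) (x + r *\<^sub>R v) = (\<lambda>t. x + t *\<^sub>R v) ` {l..r}"
proof -
  have "linear (\<lambda>t. t *\<^sub>R v)" by (rule linearI) (auto simp: algebra_simps)
  then have "closed_segment (l *\<^sub>R v) (r *\<^sub>R v) = (\<lambda>t. t *\<^sub>R v) ` {l..r}"
    using closed_segment_linear_image[of "\<lambda>t. t *\<^sub>R v" l r] assms
    by (simp add: closed_segment_eq_real_ivl)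
  then show ?thesis
    using closed_segment_translation[of x "l *\<^sub>R v" "r *\<^sub>R v"] by (simp add: image_image)
qed

text \<open>Diagonal concavity speaks of segments in the plane, whereas pieces are joined on intervals.\<close>

lemma concave_on_segment_iff_line:
  fixes F :: "'a::real_vector \<Rightarrow> real"
  assumes "l \<le> r"
  shows "concave_on (closed_segment (x + l *\<^sub>R v) (x + r *\<^sub>R v)) F
    \<longleftrightarrow> concave_on {l..r} (\<lambda>t. F (x + t *\<^sub>R v))" (is "concave_on ?S F \<longleftrightarrow> _")
proof -
  have comb: "p *\<^sub>R (x + s *\<^sub>R v) + q *\<^sub>R (x + t *\<^sub>R v) = x + (p * s + q * t) *\<^sub>R v"
    if "p + q = 1" for p q s t
  proof -
    have "p *\<^sub>R (x + s *\<^sub>R v) + q *\<^sub>R (x + t *\<^sub>R v) = (p + q) *\<^sub>R x + (p * s + q * t) *\<^sub>R v"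
      by (simp add: algebra_simps)
    then show ?thesis using that by simp
  qed
  have "concave_on ?S F \<longleftrightarrow>
     (\<forall>s\<in>{l..r}. \<forall>t\<in>{l..r}. \<forall>p\<ge>0. \<forall>q\<ge>0. p + q = 1 \<longrightarrow>
       p * F (x + s *\<^sub>R v) + q * F (x + t *\<^sub>R v) \<le> F (p *\<^sub>R (x + s *\<^sub>R v) + q *\<^sub>R (x + t *\<^sub>R v)))"
    using convex_closed_segment[of "x + l *\<^sub>R v" "x + r *\<^sub>R v"]
    unfolding concave_on_iff by (simp only: closed_segment_line[OF assms] ball_simps simp_thms)
  then show ?thesis unfolding concave_on_iff by (simp add: comb del: scaleR_right_distrib)
qed

lemma diag_concave_on_line:
  assumes conc: "diag_concave_on S B" and \<sigma>: "\<sigma> = 1 \<or> \<sigma> = -1"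
    and sub: "\<And>t. t \<in> {l..r} \<Longrightarrow> x + t *\<^sub>R (1, \<sigma>) \<in> S"
  shows "concave_on {l..r} (\<lambda>t. B (x + t *\<^sub>R (1, \<sigma>)))"
proof (cases "l \<le> r")
  case True
  let ?y = "x + l *\<^sub>R (1, \<sigma>)" and ?z = "x + r *\<^sub>R (1, \<sigma>)"
  have "closed_segment ?y ?z \<subseteq> S"
    using sub by (auto simp only: closed_segment_line[OF True])
  moreover have "?z - ?y = (r - l) *\<^sub>R (1, \<sigma>)" by (simp add: algebra_simps)
  ultimately have "concave_on (closed_segment ?y ?z) B"
    using conc \<sigma> unfolding diag_concave_on_def by metis
  then show ?thesis using concave_on_segment_iff_line[OF True] by blast
qed (simp add: concave_on_iff)

section \<open>Functions with a continuous gradient on a closed set\<close>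

definition has_gradient_on ::
  "('a::euclidean_space \<Rightarrow> real) \<Rightarrow> ('a \<Rightarrow> 'a) \<Rightarrow> 'a set \<Rightarrow> bool" where
  "has_gradient_on B G S \<longleftrightarrow>
     continuous_on S G \<and> (\<forall>x\<in>S. (B has_derivative (\<lambda>h. G x \<bullet> h)) (at x within S))"

lemma C1_smooth_on_iff: "C1_smooth_on S B \<longleftrightarrow> (\<exists>G. has_gradient_on B G S)"
  by (simp add: C1_smooth_on_def has_gradient_on_def)

text \<open>A derivative within \<open>S\<close> need not be unique. All information about \<open>G\<close> is
  therefore extracted by differentiating along curves which stay inside \<open>S\<close>.\<close>

lemma has_gradient_on_curve:
  fixes \<gamma> :: "real \<Rightarrow> 'a::euclidean_space"
  assumes G: "has_gradient_on B G S" and \<gamma>: "(\<gamma> has_vector_derivative v) (at t within I)"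
    and sub: "\<gamma> ` I \<subseteq> S" and t: "t \<in> I"
  shows "((\<lambda>t. B (\<gamma> t)) has_real_derivative G (\<gamma> t) \<bullet> v) (at t within I)"
proof -
  have "((\<lambda>t. B (\<gamma> t)) has_derivative (\<lambda>h. G (\<gamma> t) \<bullet> (h *\<^sub>R v))) (at t within I)"
    using has_derivative_in_compose2[of S B "\<lambda>x h. G x \<bullet> h" \<gamma> I t "\<lambda>h. h *\<^sub>R v"] G \<gamma> sub t
    by (auto simp: has_gradient_on_def has_vector_derivative_def)
  then show ?thesis by (simp add: has_field_derivative_def mult_commute_abs)
qed

lemma has_derivative_within_Un_closed:
  assumes "closed A" "closed B" and "x \<in> A \<union> B"
    and "x \<in> A \<Longrightarrow> (f has_derivative f') (at x within A)"
    and "x \<in> B \<Longrightarrow> (f has_derivative f') (at x within B)"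
  shows "(f has_derivative f') (at x within A \<union> B)"
proof -
  have triv: "at x within S = bot" if "closed S" "x \<notin> S" for S
    using that by (metis closed_limpt trivial_limit_within)
  have bl: "bounded_linear f'" using assms(3-5) by (auto dest: has_derivative_bounded_linear)
  let ?R = "\<lambda>y. ((f y - f x) - f' (y - x)) /\<^sub>R norm (y - x)"
  have "(?R \<longlongrightarrow> 0) (at x within A)"
    using assms(4) triv[OF assms(1)] by (cases "x \<in> A") (simp_all only: has_derivative_at_within tendsto_bot not_False_eq_True simp_thms)
  moreover have "(?R \<longlongrightarrow> 0) (at x within B)"
    using assms(5) triv[OF assms(2)] by (cases "x \<in> B") (simp_all only: has_derivative_at_within tendsto_bot not_False_eq_True simp_thms)
  ultimately have "(?R \<longlongrightarrow> 0) (at x within A \<union> B)"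
    unfolding at_within_union by (rule filterlim_sup)
  then show ?thesis
    using bl by (simp only: has_derivative_at_within simp_thms)
qed

text \<open>Closedness is what makes the two pieces independent: near a point outside \<open>B\<close> only \<open>A\<close>
  matters, and conversely, so that agreement is needed on the intersection alone.\<close>

lemma has_gradient_on_Un:
  assumes A: "has_gradient_on f F A" "closed A" and B: "has_gradient_on g G B" "closed B"
    and eq: "\<And>x. x \<in> A \<Longrightarrow> x \<in> B \<Longrightarrow> f x = g x \<and> F x = G x"
  shows "has_gradient_on (\<lambda>x. if x \<in> A then f x else g x) (\<lambda>x. if x \<in> A then F x else G x) (A \<union> B)"
proof -
  let ?f = "\<lambda>x. if x \<in> A then f x else g x" and ?F = "\<lambda>x. if x \<in> A then F x else G x"
  have onB: "?f x = g x" "?F x = G x" if "x \<in> B" for x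
    using eq[of x] that by simp_all
  have "continuous_on (A \<union> B) ?F"
  proof (rule continuous_on_If)
    show "continuous_on A F" "continuous_on B G" using A B by (simp_all add: has_gradient_on_def)
    show "F x = G x" if "x \<in> A" "x \<notin> A" for x using that by simp
    show "F x = G x" if "x \<in> B" "x \<in> A" for x using eq that by simp
  qed (use A B in auto)
  moreover have "(?f has_derivative (\<lambda>h. ?F x \<bullet> h)) (at x within A \<union> B)" if x: "x \<in> A \<union> B" for x
  proof (rule has_derivative_within_Un_closed[OF A(2) B(2) x])
    assume x: "x \<in> A"
    then have "(f has_derivative (\<lambda>h. F x \<bullet> h)) (at x within A)"
      using A(1) by (simp add: has_gradient_on_def)
    then show "(?f has_derivative (\<lambda>h. ?F x \<bullet> h)) (at x within A)"
      using has_derivative_transform[OF x, of ?f f] x by simp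
  next
    assume x: "x \<in> B"
    then have "(g has_derivative (\<lambda>h. G x \<bullet> h)) (at x within B)"
      using B(1) by (simp add: has_gradient_on_def)
    then show "(?f has_derivative (\<lambda>h. ?F x \<bullet> h)) (at x within B)"
      using has_derivative_transform[OF x, of ?f g] onB unfolding onB(2)[OF x] by blast
  qed
  ultimately show ?thesis by (simp add: has_gradient_on_def)
qed

section \<open>Bilinear functions on the rectangle\<close>

definition bilin :: "real \<Rightarrow> real \<Rightarrow> real \<Rightarrow> real \<Rightarrow> real \<times> real \<Rightarrow> real" where
  "bilin a b c d x = a * ((fst x)\<^sup>2 - (snd x)\<^sup>2) + b * fst x + c * snd x + d"

definition bilin_gradient :: "real \<Rightarrow> real \<Rightarrow> real \<Rightarrow> real \<times> real \<Rightarrow> real \<times> real" where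
  "bilin_gradient a b c x = (2 * a * fst x + b, - 2 * a * snd x + c)"

lemma has_gradient_on_bilin: "has_gradient_on (bilin a b c d) (bilin_gradient a b c) S"
proof -
  have "(bilin a b c d has_derivative (\<lambda>h. bilin_gradient a b c x \<bullet> h)) (at x within S)" for x
    unfolding bilin_def bilin_gradient_def
    by (auto intro!: derivative_eq_intros simp: fun_eq_iff inner_prod_def algebra_simps)
  moreover have "continuous_on S (bilin_gradient a b c)"
    unfolding bilin_gradient_def by (intro continuous_intros)
  ultimately show ?thesis by (simp add: has_gradient_on_def)
qed

lemma bilinear_function_iff_bilin: "bilinear_function g \<longleftrightarrow> (\<exists>a b c d. g = bilin a b c d)"
  by (auto simp: bilinear_function_def bilin_def fun_eq_iff)

text \<open>The rectangle has its sides on the diagonals, so it is a product of two intervals in the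
  coordinates \<open>x\<^sub>1 + x\<^sub>2\<close> and \<open>x\<^sub>1 - x\<^sub>2\<close>. The parameters \<open>r\<close> and \<open>t\<close> run through them from \<open>0\<close> to
  \<open>1\<close>; they also exist when \<open>\<bar>C2\<bar> = \<epsilon>\<close> and one of the intervals is a point.\<close>

lemma rectangle_coordinates:
  fixes x :: "real \<times> real"
  assumes "x \<in> {x. \<bar>fst x - C1 + snd x\<bar> \<le> \<epsilon> + C2 \<and> \<bar>fst x - C1 - snd x\<bar> \<le> \<epsilon> - C2}"
  shows "\<exists>r\<in>{0..1}. \<exists>t\<in>{0..1}.
    x = (C1 + ((2 * r - 1) * (\<epsilon> + C2) + (2 * t - 1) * (\<epsilon> - C2)) / 2,
        ((2 * r - 1) * (\<epsilon> + C2) - (2 * t - 1) * (\<epsilon> - C2)) / 2)"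
proof -
  have ex: "\<exists>r\<in>{0..1}. y = (2 * r - 1) * e" if "\<bar>y\<bar> \<le> e" for y e :: real
  proof (cases "e = 0")
    case False
    then show ?thesis using that by (intro bexI[of _ "(y + e) / (2 * e)"]) (auto simp: divide_simps)
  qed (use that in auto)
  obtain r t where r: "r \<in> {0..1}" "fst x - C1 + snd x = (2 * r - 1) * (\<epsilon> + C2)"
    and t: "t \<in> {0..1}" "fst x - C1 - snd x = (2 * t - 1) * (\<epsilon> - C2)"
    using ex assms by blast
  have "x = (C1 + ((2 * r - 1) * (\<epsilon> + C2) + (2 * t - 1) * (\<epsilon> - C2)) / 2,
      ((2 * r - 1) * (\<epsilon> + C2) - (2 * t - 1) * (\<epsilon> - C2)) / 2)"
    unfolding r(2)[symmetric] t(2)[symmetric] by (simp add: prod_eq_iff field_simps)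
  with r(1) t(1) show ?thesis by blast
qed

lemma middle_rectangle_eq:
  assumes "0 < \<epsilon>" and "\<bar>C2\<bar> \<le> \<epsilon>"
  shows "middle_rectangle \<epsilon> C1 C2 =
    {x. \<bar>fst x - C1 + snd x\<bar> \<le> \<epsilon> + C2 \<and> \<bar>fst x - C1 - snd x\<bar> \<le> \<epsilon> - C2}" (is "?M = ?R")
proof
  have "convex {x :: real \<times> real. \<bar>fst x - C1 + k * snd x\<bar> \<le> e}" for k e
  proof -
    have "{x :: real \<times> real. \<bar>fst x - C1 + k * snd x\<bar> \<le> e} =
        {x. (1, k) \<bullet> x \<le> C1 + e} \<inter> {x. (1, k) \<bullet> x \<ge> C1 - e}"
      by (auto simp: inner_prod_def)
    then show ?thesis by (simp add: convex_Int convex_halfspace_le convex_halfspace_ge)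
  qed
  from convex_Int[OF this[of 1 "\<epsilon> + C2"] this[of "-1" "\<epsilon> - C2"]]
  have "convex ?R" by (simp add: Collect_conj_eq)
  then show "?M \<subseteq> ?R"
    unfolding middle_rectangle_def by (intro hull_minimal) (use assms in auto)
next
  show "?R \<subseteq> ?M"
  proof
    fix x assume x: "x \<in> ?R"
    then obtain r t where r: "r \<in> {0..1}" and t: "t \<in> {0..1}"
      and x_eq: "x = (C1 + ((2 * r - 1) * (\<epsilon> + C2) + (2 * t - 1) * (\<epsilon> - C2)) / 2,
        ((2 * r - 1) * (\<epsilon> + C2) - (2 * t - 1) * (\<epsilon> - C2)) / 2)"
      using rectangle_coordinates by blast
    let ?N = "(C1 + C2, \<epsilon>)" and ?E = "(C1 + \<epsilon>, C2)" and ?S = "(C1 - C2, -\<epsilon>)" and ?W = "(C1 - \<epsilon>, -C2)"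
    have conv: "convex ?M" by (simp add: middle_rectangle_def)
    have mem: "{?N, ?E, ?S, ?W} \<subseteq> ?M" unfolding middle_rectangle_def by (rule hull_subset)
    have "(1 - t) *\<^sub>R ?N + t *\<^sub>R ?E \<in> ?M" "(1 - t) *\<^sub>R ?W + t *\<^sub>R ?S \<in> ?M"
      using mem t by (auto simp del: scaleR_Pair add_Pair intro!: convexD_alt[OF conv])
    then have "(1 - r) *\<^sub>R ((1 - t) *\<^sub>R ?W + t *\<^sub>R ?S) + r *\<^sub>R ((1 - t) *\<^sub>R ?N + t *\<^sub>R ?E) \<in> ?M"
      using r by (auto simp del: scaleR_Pair add_Pair intro!: convexD_alt[OF conv])
    moreover have "(1 - r) *\<^sub>R ((1 - t) *\<^sub>R ?W + t *\<^sub>R ?S) + r *\<^sub>R ((1 - t) *\<^sub>R ?N + t *\<^sub>R ?E) = x"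
      by (simp add: x_eq field_simps)
    ultimately show "x \<in> ?M" by simp
  qed
qed

text \<open>In the coordinates of the rectangle the value at \<open>x\<close> is a bilinear interpolation of the four
  vertex values. The argument also covers the rectangle that degenerates to a diagonal segment, where the
  vertex values no longer determine the coefficients.\<close>

lemma bilinear_function_rectangle_unique:
  assumes "0 < \<epsilon>" "\<bar>C2\<bar> \<le> \<epsilon>" and g: "bilinear_function g" "bilinear_function h"
    and eq: "g (C1 + C2, \<epsilon>) = h (C1 + C2, \<epsilon>)" "g (C1 - C2, -\<epsilon>) = h (C1 - C2, -\<epsilon>)"
      "g (C1 + \<epsilon>, C2) = h (C1 + \<epsilon>, C2)" "g (C1 - \<epsilon>, -C2) = h (C1 - \<epsilon>, -C2)"
    and x: "x \<in> middle_rectangle \<epsilon> C1 C2"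
  shows "g x = h x"
proof -
  obtain r t where x_eq: "x = (C1 + ((2 * r - 1) * (\<epsilon> + C2) + (2 * t - 1) * (\<epsilon> - C2)) / 2,
      ((2 * r - 1) * (\<epsilon> + C2) - (2 * t - 1) * (\<epsilon> - C2)) / 2)"
    using x rectangle_coordinates unfolding middle_rectangle_eq[OF assms(1,2)] by blast
  have "k x = (1 - r) * ((1 - t) * k (C1 - \<epsilon>, -C2) + t * k (C1 - C2, -\<epsilon>))
      + r * ((1 - t) * k (C1 + C2, \<epsilon>) + t * k (C1 + \<epsilon>, C2))" if "bilinear_function k" for k
    using that unfolding bilinear_function_iff_bilin x_eq
    by (auto simp: bilin_def field_simps power2_eq_square)
  then show ?thesis using g eq by metis
qed

section \<open>Herringbones issuing from the rectangle\<close>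

text \<open>The mean value theorem needs \<open>\<bar>T'\<bar> < 1\<close> only inside the interval, so continuity of \<open>T\<close> at the
  ends gives the bound there too.\<close>

lemma spine_lipschitz:
  fixes T :: "real \<Rightarrow> real"
  assumes "spine \<epsilon> T p q" and "u \<in> {p..q}" "v \<in> {p..q}"
  shows "\<bar>T u - T v\<bar> \<le> \<bar>u - v\<bar>"
proof -
  have key: "\<bar>T y - T x\<bar> \<le> y - x" if xy: "x < y" "x \<in> {p..q}" "y \<in> {p..q}" for x y
  proof -
    have "continuous_on {x..y} T"
      using assms(1) xy by (auto simp: spine_def intro: continuous_on_subset)
    moreover have "T differentiable (at z)" if "x < z" "z < y" for z
      using assms(1) xy that unfolding spine_def C1_differentiable_on_eq by auto
    ultimately obtain l z where z: "x < z" "z < y" "DERIV T z :> l" "T y - T x = (y - x) * l"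
      using MVT[OF xy(1), of T] by blast
    then have "\<bar>l\<bar> < 1"
      using assms(1) xy DERIV_imp_deriv[OF z(3)] by (auto simp: spine_def)
    then have "\<bar>(y - x) * l\<bar> \<le> (y - x) * 1"
      using xy(1) unfolding abs_mult by (intro mult_mono) auto
    then show ?thesis using z(4) by simp
  qed
  from key[of u v] key[of v u] assms(2,3) show ?thesis by (cases u v rule: linorder_cases) auto
qed

lemma spine_derivative:
  assumes "spine \<epsilon> T p q" and "u \<in> {p<..<q}"
  shows "(T has_real_derivative deriv T u) (at u)" and "\<bar>deriv T u\<bar> < 1" and "\<bar>T u\<bar> < \<epsilon>"
proof -
  have "T differentiable (at u)"
    using assms unfolding spine_def C1_differentiable_on_eq by blast
  then show "(T has_real_derivative deriv T u) (at u)"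
    by (simp add: DERIV_deriv_iff_real_differentiable)
qed (use assms in \<open>auto simp: spine_def\<close>)

text \<open>The sign \<open>\<kappa>\<close> is \<open>1\<close> for left and \<open>-1\<close> for right herringbones, the sign \<open>\<eta>\<close> is \<open>1\<close> for upper
  and \<open>-1\<close> for lower ribs. With these signs the reflections of the strip in both coordinate axes act on
  the parameters only, so one argument serves both herringbones and all ribs. A rib has the direction
  \<open>(\<kappa>, - \<eta>)\<close>.\<close>

definition rib_end :: "real \<Rightarrow> (real \<Rightarrow> real) \<Rightarrow> real \<Rightarrow> real \<Rightarrow> real \<Rightarrow> real \<times> real" where
  "rib_end \<epsilon> T \<kappa> \<eta> u = (u + \<kappa> * (\<eta> * T u - \<epsilon>), \<eta> * \<epsilon>)"

text \<open>A herringbone whose spine starts at the vertex \<open>(C1 + \<kappa> \<epsilon>, \<kappa> C2)\<close> of the rectangle, together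
  with a bilinear function which has, at the vertices \<open>(C1 + \<eta> C2, \<eta> \<epsilon>)\<close> on the boundary of the strip,
  the value \<open>f \<eta>\<close> and the horizontal derivative \<open>f' \<eta>\<close>. Requiring the two horizontal derivatives there
  instead of the values at the two spine vertices makes the system for the coefficients solvable and
  uniquely so for every \<open>C2 \<noteq> 0\<close>, including \<open>\<bar>C2\<bar> = \<epsilon>\<close>; that the spine vertices are then fitted
  as well is a consequence of the formula for the spine values.\<close>

locale herringbone_at_rectangle =
  fixes \<epsilon> \<kappa> C1 C2 p q a b c d :: real
    and T :: "real \<Rightarrow> real" and f f' :: "real \<Rightarrow> real \<Rightarrow> real"
    and B :: "real \<times> real \<Rightarrow> real" and G :: "real \<times> real \<Rightarrow> real \<times> real" and D :: "(real \<times> real) set"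
  assumes eps_pos: "0 < \<epsilon>" and kappa: "\<kappa> = 1 \<or> \<kappa> = -1"
    and C2_nonzero: "C2 \<noteq> 0" and C2_le: "\<bar>C2\<bar> \<le> \<epsilon>"
    and spine: "spine \<epsilon> T p q" and T_le: "\<And>u. u \<in> {p..q} \<Longrightarrow> \<bar>T u\<bar> \<le> \<epsilon>"
    and start_mem: "C1 + \<kappa> * \<epsilon> \<in> {p..q}"
    and start_extreme: "\<And>u. u \<in> {p..q} \<Longrightarrow> 0 \<le> \<kappa> * (u - (C1 + \<kappa> * \<epsilon>))"
    and T_start: "T (C1 + \<kappa> * \<epsilon>) = \<kappa> * C2"
    and D_eq: "D = herringbone_domain T (rib_end \<epsilon> T \<kappa> 1) (rib_end \<epsilon> T \<kappa> (-1)) p q"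
    and gradient: "has_gradient_on B G D"
    and boundary: "\<And>\<eta> x. \<eta> = 1 \<or> \<eta> = -1 \<Longrightarrow> (x, \<eta> * \<epsilon>) \<in> D \<Longrightarrow> B (x, \<eta> * \<epsilon>) = f \<eta> x"
    and boundary_deriv: "\<And>\<eta> x. \<eta> = 1 \<or> \<eta> = -1 \<Longrightarrow> (f \<eta> has_real_derivative f' \<eta> x) (at x)"
    and boundary_deriv_cont: "\<And>\<eta>. \<eta> = 1 \<or> \<eta> = -1 \<Longrightarrow> continuous_on UNIV (f' \<eta>)"
    and affine: "\<And>\<eta> u. \<eta> = 1 \<or> \<eta> = -1 \<Longrightarrow> u \<in> {p..q} \<Longrightarrow>
        affine_on_segment (u, T u) (rib_end \<epsilon> T \<kappa> \<eta> u) B"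
    and start_value: "B (C1 + \<kappa> * \<epsilon>, \<kappa> * C2) =
        (\<epsilon>\<^sup>2 - C2\<^sup>2) / (2 * \<epsilon> * C2)
          * ((\<epsilon> + \<kappa> * C2) * f' 1 (C1 + C2) - (\<epsilon> - \<kappa> * C2) * f' (-1) (C1 - C2))
        + ((\<epsilon> + \<kappa> * C2) * f 1 (C1 + C2) + (\<epsilon> - \<kappa> * C2) * f (-1) (C1 - C2)) / (2 * \<epsilon>)"
    and vertex_value: "\<And>\<eta>. \<eta> = 1 \<or> \<eta> = -1 \<Longrightarrow>
        bilin a b c d (C1 + \<eta> * C2, \<eta> * \<epsilon>) = f \<eta> (C1 + \<eta> * C2)"
    and vertex_slope: "\<And>\<eta>. \<eta> = 1 \<or> \<eta> = -1 \<Longrightarrow>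
        2 * a * (C1 + \<eta> * C2) + b = f' \<eta> (C1 + \<eta> * C2)"
begin

definition rib_point :: "real \<Rightarrow> real \<Rightarrow> real \<Rightarrow> real \<times> real" where
  "rib_point \<eta> u r = (1 - r) *\<^sub>R rib_end \<epsilon> T \<kappa> \<eta> u + r *\<^sub>R (u, T u)"

lemma rib_point_0 [simp]: "rib_point \<eta> u 0 = rib_end \<epsilon> T \<kappa> \<eta> u"
  and rib_point_1 [simp]: "rib_point \<eta> u 1 = (u, T u)"
  by (simp_all add: rib_point_def zero_prod_def)

lemma domain_eq: "D = (\<Union>\<eta>\<in>{1, -1}. (\<lambda>(u, r). rib_point \<eta> u r) ` ({p..q} \<times> {0..1}))"
proof -
  have "closed_segment (u, T u) (rib_end \<epsilon> T \<kappa> \<eta> u) = rib_point \<eta> u ` {0..1}" for \<eta> u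
    by (subst closed_segment_commute) (simp add: closed_segment_image_interval rib_point_def)
  moreover have "(\<lambda>(u, r). rib_point \<eta> u r) ` ({p..q} \<times> {0..1}) = (\<Union>u\<in>{p..q}. rib_point \<eta> u ` {0..1})" for \<eta>
    by (force simp: image_iff)
  ultimately show ?thesis
    unfolding D_eq herringbone_domain_def by (simp add: UN_Un_distrib)
qed

lemma rib_point_mem:
  "\<eta> = 1 \<or> \<eta> = -1 \<Longrightarrow> u \<in> {p..q} \<Longrightarrow> r \<in> {0..1} \<Longrightarrow> rib_point \<eta> u r \<in> D"
  unfolding domain_eq by force

lemma domainE:
  assumes "x \<in> D"
  obtains \<eta> u r where "\<eta> = 1 \<or> \<eta> = -1" "u \<in> {p..q}" "r \<in> {0..1}" "x = rib_point \<eta> u r"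
proof -
  from assms obtain \<eta> where \<eta>: "\<eta> \<in> {1, -1}"
    and x: "x \<in> (\<lambda>(u, r). rib_point \<eta> u r) ` ({p..q} \<times> {0..1})"
    unfolding domain_eq by (rule UN_E)
  from x obtain u r where ur: "u \<in> {p..q}" "r \<in> {0..1}" "x = rib_point \<eta> u r"
    by (elim imageE SigmaE) simp
  show thesis by (rule that[OF _ ur]) (use \<eta> in simp)
qed

lemma T_cont: "continuous_on {p..q} T"
  using spine by (simp add: spine_def)

lemma closed_domain: "closed D"
proof -
  have "continuous_on ({p..q} \<times> {0..1}) (\<lambda>(u, r). rib_point \<eta> u r)" for \<eta>
    unfolding rib_point_def rib_end_def case_prod_beta
    by (intro continuous_intros continuous_on_compose2[OF T_cont]) auto
  then have "compact D"
    unfolding domain_eq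
    by (intro compact_UN) (auto intro!: compact_continuous_image compact_Times)
  then show ?thesis by (rule compact_imp_closed)
qed

lemma domain_subset_strip: "D \<subseteq> strip \<epsilon>"
proof
  fix x assume "x \<in> D"
  then obtain \<eta> u r where \<eta>: "\<eta> = 1 \<or> \<eta> = -1" and u: "u \<in> {p..q}" and l: "r \<in> {0..1}"
    and x: "x = rib_point \<eta> u r" by (rule domainE)
  have "\<bar>(1 - r) * (\<eta> * \<epsilon>) + r * T u\<bar> \<le> (1 - r) * \<epsilon> + r * \<epsilon>"
    using \<eta> l T_le[OF u] eps_pos
    by (intro abs_triangle_ineq[THEN order_trans] add_mono) (auto simp: abs_mult intro: mult_left_mono)
  then show "x \<in> strip \<epsilon>" by (simp add: x strip_def rib_point_def rib_end_def algebra_simps)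
qed

text \<open>Along a rib \<open>\<kappa> x\<^sub>1 + \<eta> x\<^sub>2\<close> is constant. At the spine it is \<open>\<kappa> u + \<eta> T u\<close>, which is
  smallest at the start since \<open>T\<close> is 1-Lipschitz. So the domain lies beyond the line through one of the two
  sides of the rectangle that meet in the starting vertex.\<close>

lemma domain_side:
  assumes "x \<in> D"
  shows "\<exists>\<eta>. (\<eta> = 1 \<or> \<eta> = -1) \<and> \<epsilon> + \<eta> * \<kappa> * C2 \<le> \<kappa> * (fst x - C1) + \<eta> * snd x"
proof -
  obtain \<eta> u r where \<eta>: "\<eta> = 1 \<or> \<eta> = -1" and u: "u \<in> {p..q}" and l: "r \<in> {0..1}"
    and x: "x = rib_point \<eta> u r" using assms by (rule domainE)
  have "\<kappa> * fst x + \<eta> * snd x = \<kappa> * u + \<eta> * T u"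
    using \<eta> kappa by (auto simp: x rib_point_def rib_end_def algebra_simps)
  moreover have "\<bar>T u - \<kappa> * C2\<bar> \<le> \<kappa> * (u - (C1 + \<kappa> * \<epsilon>))"
    using spine_lipschitz[OF spine u start_mem] start_extreme[OF u] kappa T_start by auto
  ultimately have "\<epsilon> + \<eta> * \<kappa> * C2 \<le> \<kappa> * (fst x - C1) + \<eta> * snd x"
    using \<eta> kappa by (auto simp: algebra_simps)
  then show ?thesis using \<eta> by blast
qed

lemma rib_value:
  assumes "\<eta> = 1 \<or> \<eta> = -1" "u \<in> {p..q}" "r \<in> {0..1}"
  shows "B (rib_point \<eta> u r) = (1 - r) * B (rib_end \<epsilon> T \<kappa> \<eta> u) + r * B (u, T u)"
  using affine[OF assms(1,2)] assms(3)
  unfolding affine_on_segment_def rib_point_def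
  by (auto dest!: bspec[of _ _ "1 - r"] simp: add.commute)

lemma rib_end_value:
  assumes "\<eta> = 1 \<or> \<eta> = -1" "u \<in> {p..q}"
  shows "B (rib_end \<epsilon> T \<kappa> \<eta> u) = f \<eta> (u + \<kappa> * (\<eta> * T u - \<epsilon>))"
  using boundary[OF assms(1)] rib_point_mem[OF assms, of 0] by (simp add: rib_end_def)

lemma gradient_along_rib:
  assumes \<eta>: "\<eta> = 1 \<or> \<eta> = -1" and u: "u \<in> {p..q}" and l: "r \<in> {0..1}"
  shows "G (rib_point \<eta> u r) \<bullet> ((u, T u) - rib_end \<epsilon> T \<kappa> \<eta> u) = B (u, T u) - B (rib_end \<epsilon> T \<kappa> \<eta> u)"
proof -
  let ?v = "(u, T u) - rib_end \<epsilon> T \<kappa> \<eta> u"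
  have "(rib_point \<eta> u has_vector_derivative ?v) (at r within {0..1})"
    unfolding rib_point_def by (auto intro!: derivative_eq_intros simp: algebra_simps)
  then have "((\<lambda>r. B (rib_point \<eta> u r)) has_real_derivative G (rib_point \<eta> u r) \<bullet> ?v) (at r within {0..1})"
    using has_gradient_on_curve[OF gradient] rib_point_mem[OF \<eta> u] l by blast
  moreover have "((\<lambda>r. (1 - r) * B (rib_end \<epsilon> T \<kappa> \<eta> u) + r * B (u, T u)) has_real_derivative
      B (u, T u) - B (rib_end \<epsilon> T \<kappa> \<eta> u)) (at r within {0..1})"
    by (auto intro!: derivative_eq_intros)
  then have "((\<lambda>r. B (rib_point \<eta> u r)) has_real_derivative
      B (u, T u) - B (rib_end \<epsilon> T \<kappa> \<eta> u)) (at r within {0..1})"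
    using rib_value[OF \<eta> u] l by (auto intro: has_field_derivative_transform_within[OF _ zero_less_one])
  ultimately show ?thesis
    using vector_derivative_unique_within_closed_interval[of 0 1 r] l
    by (simp add: has_real_derivative_iff_has_vector_derivative cbox_interval)
qed

text \<open>The transversal derivative is affine along each rib. Moving \<open>u\<close> with \<open>r\<close> fixed, the value at the
  point that divides the rib in the ratio \<open>r\<close> is \<open>(1 - r) f + r B (u, T u)\<close>. Differentiating this identity in
  \<open>u\<close> gives the claim: the components of the velocities along the rib contribute equally on both sides, and
  all transversal components contain the common factor \<open>1 + \<kappa> \<eta> T' u > 0\<close>.\<close>

lemma gradient_across_rib_interior:
  assumes \<eta>: "\<eta> = 1 \<or> \<eta> = -1" and u: "u \<in> {p<..<q}" and l: "r \<in> {0..1}"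
  shows "fst (G (rib_point \<eta> u r)) = (1 - r) * f' \<eta> (u + \<kappa> * (\<eta> * T u - \<epsilon>)) + r * fst (G (u, T u))"
proof -
  let ?I = "{p<..<q}" and ?m = "deriv T u" and ?s = "1 + \<kappa> * \<eta> * deriv T u"
  have u': "u \<in> {p..q}" using u by auto
  have dT: "(T has_real_derivative ?m) (at u within ?I)"
    using spine_derivative[OF spine u] by (simp add: has_field_derivative_at_within)
  have dT': "(T has_vector_derivative ?m) (at u within ?I)"
    using dT by (simp add: has_real_derivative_iff_has_vector_derivative)
  have at_u: "at u within ?I = at u" using u by (simp add: at_within_open[OF u])
  have curve: "((\<lambda>u. rib_point \<eta> u r) has_vector_derivative
      (1 - r) *\<^sub>R (?s, 0) + r *\<^sub>R (1, ?m)) (at u within ?I)" for r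
    unfolding rib_point_def rib_end_def
    by (auto intro!: derivative_eq_intros has_vector_derivative_Pair dT dT' simp: algebra_simps)
  have along: "((\<lambda>u. B (rib_point \<eta> u r)) has_real_derivative
      G (rib_point \<eta> u r) \<bullet> ((1 - r) *\<^sub>R (?s, 0) + r *\<^sub>R (1, ?m))) (at u within ?I)"
    if "r \<in> {0..1}" for r
  proof (rule has_gradient_on_curve[OF gradient curve _ u])
    show "(\<lambda>u. rib_point \<eta> u r) ` ?I \<subseteq> D" using rib_point_mem[OF \<eta> _ that] by auto
  qed
  have "((\<lambda>u. (1 - r) * f \<eta> (u + \<kappa> * (\<eta> * T u - \<epsilon>)) + r * B (u, T u)) has_real_derivative
      (1 - r) * (f' \<eta> (u + \<kappa> * (\<eta> * T u - \<epsilon>)) * ?s) + r * (G (u, T u) \<bullet> (1, ?m))) (at u within ?I)"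
  proof -
    have "((\<lambda>u. f \<eta> (u + \<kappa> * (\<eta> * T u - \<epsilon>))) has_real_derivative
        f' \<eta> (u + \<kappa> * (\<eta> * T u - \<epsilon>)) * ?s) (at u within ?I)"
      by (rule DERIV_chain2[OF boundary_deriv[OF \<eta>]])
        (auto intro!: derivative_eq_intros dT simp: algebra_simps)
    then show ?thesis using along[of 1] by (auto intro!: DERIV_add DERIV_cmult)
  qed
  then have "((\<lambda>u. B (rib_point \<eta> u r)) has_real_derivative
      (1 - r) * (f' \<eta> (u + \<kappa> * (\<eta> * T u - \<epsilon>)) * ?s) + r * (G (u, T u) \<bullet> (1, ?m))) (at u within ?I)"
    unfolding has_field_derivative_def
    by (rule has_derivative_transform[OF u, rotated])
      (use rib_value[OF \<eta> _ l] rib_end_value[OF \<eta>] in auto)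
  with along[OF l] have eq: "G (rib_point \<eta> u r) \<bullet> ((1 - r) *\<^sub>R (?s, 0) + r *\<^sub>R (1, ?m)) =
      (1 - r) * (f' \<eta> (u + \<kappa> * (\<eta> * T u - \<epsilon>)) * ?s) + r * (G (u, T u) \<bullet> (1, ?m))"
    unfolding at_u by (rule DERIV_unique)
  \<comment> \<open>The slope along the rib cancels, which leaves the transversal components.\<close>
  have w: "(u, T u) - rib_end \<epsilon> T \<kappa> \<eta> u = (\<epsilon> - \<eta> * T u) *\<^sub>R (\<kappa>, - \<eta>)"
    using \<eta> by (auto simp: rib_end_def algebra_simps)
  have "\<epsilon> - \<eta> * T u \<noteq> 0" using spine_derivative(3)[OF spine u] \<eta> by auto
  moreover have "G (rib_point \<eta> u r) \<bullet> ((u, T u) - rib_end \<epsilon> T \<kappa> \<eta> u) = G (u, T u) \<bullet> ((u, T u) - rib_end \<epsilon> T \<kappa> \<eta> u)"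
    using gradient_along_rib[OF \<eta> u' l] gradient_along_rib[OF \<eta> u', of 1] by simp
  ultimately have "G (rib_point \<eta> u r) \<bullet> (\<kappa>, - \<eta>) = G (u, T u) \<bullet> (\<kappa>, - \<eta>)"
    unfolding w by (simp del: scaleR_Pair)
  then have snd_eq: "snd (G (rib_point \<eta> u r)) = snd (G (u, T u)) + \<eta> * \<kappa> * (fst (G (rib_point \<eta> u r)) - fst (G (u, T u)))"
    using \<eta> kappa by (auto simp: inner_prod_def)
  have "?s * fst (G (rib_point \<eta> u r)) = ?s * ((1 - r) * f' \<eta> (u + \<kappa> * (\<eta> * T u - \<epsilon>)) + r * fst (G (u, T u)))"
    using eq by (simp add: inner_prod_def snd_eq algebra_simps)
  moreover have "?s \<noteq> 0" using spine_derivative(2)[OF spine u] \<eta> kappa by auto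
  ultimately show ?thesis by simp
qed

text \<open>Only the ribs from the start of the spine touch the rectangle, and there \<open>T\<close> need not be
  differentiable. The formula extends to them by continuity of the gradient.\<close>

lemma gradient_across_rib:
  assumes \<eta>: "\<eta> = 1 \<or> \<eta> = -1" and u: "u \<in> {p..q}" and l: "r \<in> {0..1}"
  shows "fst (G (rib_point \<eta> u r)) = (1 - r) * f' \<eta> (u + \<kappa> * (\<eta> * T u - \<epsilon>)) + r * fst (G (u, T u))"
proof -
  let ?h = "\<lambda>u. fst (G (rib_point \<eta> u r)) - ((1 - r) * f' \<eta> (u + \<kappa> * (\<eta> * T u - \<epsilon>)) + r * fst (G (rib_point \<eta> u 1)))"
  have G: "continuous_on D G" using gradient by (simp add: has_gradient_on_def)
  have rib: "continuous_on {p..q} (\<lambda>u. G (rib_point \<eta> u r))" if "r \<in> {0..1}" for r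
  proof (rule continuous_on_compose2[OF G])
    show "continuous_on {p..q} (\<lambda>u. rib_point \<eta> u r)"
      unfolding rib_point_def rib_end_def by (intro continuous_intros T_cont)
  qed (use rib_point_mem[OF \<eta> _ that] in auto)
  have "continuous_on {p..q} ?h"
    by (intro continuous_intros rib continuous_on_compose2[OF boundary_deriv_cont[OF \<eta>]] T_cont l)
      auto
  moreover have "p < q" using spine by (simp add: spine_def)
  moreover have "?h v = 0" if "v \<in> {p<..<q}" for v
    using gradient_across_rib_interior[OF \<eta> that l] by simp
  ultimately have "?h u = 0"
    using continuous_constant_on_closure[of "{p<..<q}" ?h 0 u] u by simp
  then show ?thesis by simp
qed

lemma start_abscissa: "C1 + \<kappa> * \<epsilon> + \<kappa> * (\<eta> * T (C1 + \<kappa> * \<epsilon>) - \<epsilon>) = C1 + \<eta> * C2"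
  unfolding T_start using kappa by auto

lemma start_rib_point:
  "rib_point \<eta> (C1 + \<kappa> * \<epsilon>) r = (1 - r) *\<^sub>R (C1 + \<eta> * C2, \<eta> * \<epsilon>) + r *\<^sub>R (C1 + \<kappa> * \<epsilon>, \<kappa> * C2)"
  unfolding rib_point_def rib_end_def T_start using kappa by (auto simp: algebra_simps)

lemma start_rib_end:
  "rib_end \<epsilon> T \<kappa> \<eta> (C1 + \<kappa> * \<epsilon>) = (C1 + \<eta> * C2, \<eta> * \<epsilon>)"
  using start_rib_point[of \<eta> 0] by simp

text \<open>Ribs are diagonal and \<open>x\<^sub>1\<^sup>2 - x\<^sub>2\<^sup>2\<close> is affine on diagonals.\<close>

lemma bilin_start_rib:
  assumes "\<eta> = 1 \<or> \<eta> = -1"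
  shows "bilin a b c d (rib_point \<eta> (C1 + \<kappa> * \<epsilon>) r) =
      (1 - r) * bilin a b c d (C1 + \<eta> * C2, \<eta> * \<epsilon>) + r * bilin a b c d (C1 + \<kappa> * \<epsilon>, \<kappa> * C2)"
    and "bilin_gradient a b c (rib_point \<eta> (C1 + \<kappa> * \<epsilon>) r)
        \<bullet> ((C1 + \<kappa> * \<epsilon>, \<kappa> * C2) - (C1 + \<eta> * C2, \<eta> * \<epsilon>)) =
      bilin a b c d (C1 + \<kappa> * \<epsilon>, \<kappa> * C2) - bilin a b c d (C1 + \<eta> * C2, \<eta> * \<epsilon>)"
  unfolding start_rib_point using assms kappa
  by (auto simp: bilin_def bilin_gradient_def inner_prod_def power2_eq_square algebra_simps)

text \<open>This is the identity behind the theorem: applied to the boundary values and horizontal derivatives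
  of a bilinear function, the formula for the spine values returns the value of this function at the
  spine vertex.\<close>

lemma start_value_bilin: "B (C1 + \<kappa> * \<epsilon>, \<kappa> * C2) = bilin a b c d (C1 + \<kappa> * \<epsilon>, \<kappa> * C2)"
proof -
  have vertices: "f 1 (C1 + C2) = bilin a b c d (C1 + C2, \<epsilon>)" "f (-1) (C1 - C2) = bilin a b c d (C1 - C2, - \<epsilon>)"
    "f' 1 (C1 + C2) = 2 * a * (C1 + C2) + b" "f' (-1) (C1 - C2) = 2 * a * (C1 - C2) + b"
    using vertex_value[of 1] vertex_value[of "-1"] vertex_slope[of 1] vertex_slope[of "-1"] by simp_all
  show ?thesis
    unfolding start_value vertices bilin_def using kappa eps_pos C2_nonzero
    by (auto simp: field_simps power2_eq_square)
qed

lemma start_rib_value: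
  assumes "\<eta> = 1 \<or> \<eta> = -1" "r \<in> {0..1}"
  shows "B (rib_point \<eta> (C1 + \<kappa> * \<epsilon>) r) = bilin a b c d (rib_point \<eta> (C1 + \<kappa> * \<epsilon>) r)"
  using rib_value[OF assms(1) start_mem assms(2)] rib_end_value[OF assms(1) start_mem] vertex_value[OF assms(1)]
  unfolding bilin_start_rib(1)[OF assms(1)] start_abscissa
  unfolding start_rib_end T_start start_value_bilin by simp

lemma gradient_start_along:
  assumes \<eta>: "\<eta> = 1 \<or> \<eta> = -1" and r: "r \<in> {0..1}" and nondeg: "\<epsilon> \<noteq> \<eta> * \<kappa> * C2"
  shows "G (rib_point \<eta> (C1 + \<kappa> * \<epsilon>) r) \<bullet> (\<kappa>, - \<eta>) =
    bilin_gradient a b c (rib_point \<eta> (C1 + \<kappa> * \<epsilon>) r) \<bullet> (\<kappa>, - \<eta>)"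
proof -
  let ?P = "(C1 + \<eta> * C2, \<eta> * \<epsilon>)" and ?Q = "(C1 + \<kappa> * \<epsilon>, \<kappa> * C2)"
  have w: "?Q - ?P = (\<epsilon> - \<eta> * \<kappa> * C2) *\<^sub>R (\<kappa>, - \<eta>)"
    using \<eta> kappa by (auto simp: algebra_simps)
  have "G (rib_point \<eta> (C1 + \<kappa> * \<epsilon>) r) \<bullet> (?Q - ?P) = B ?Q - B ?P"
    using gradient_along_rib[OF \<eta> start_mem r] by (simp only: start_rib_end T_start)
  also have "\<dots> = bilin a b c d ?Q - bilin a b c d ?P"
    using start_rib_value[OF \<eta>, of 0] start_value_bilin by (simp add: start_rib_end)
  also have "\<dots> = bilin_gradient a b c (rib_point \<eta> (C1 + \<kappa> * \<epsilon>) r) \<bullet> (?Q - ?P)"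
    using bilin_start_rib(2)[OF \<eta>] by simp
  finally show ?thesis unfolding w using nondeg by (simp del: scaleR_Pair)
qed

lemma fst_gradient_rib_end:
  assumes \<eta>: "\<eta> = 1 \<or> \<eta> = -1"
  shows "fst (G (C1 + \<eta> * C2, \<eta> * \<epsilon>)) = fst (bilin_gradient a b c (C1 + \<eta> * C2, \<eta> * \<epsilon>))"
  using gradient_across_rib[OF \<eta> start_mem, of 0] vertex_slope[OF \<eta>]
  unfolding start_abscissa rib_point_0 start_rib_end by (simp add: bilin_gradient_def)

text \<open>If \<open>\<bar>C2\<bar> < \<epsilon>\<close>, the two ribs from the starting vertex have independent directions, along both of which
  the slopes agree. If \<open>\<bar>C2\<bar> = \<epsilon>\<close>, one rib is a point on the boundary of the strip, where the horizontal
  derivative takes the place of the missing slope.\<close>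

lemma gradient_start: "G (C1 + \<kappa> * \<epsilon>, \<kappa> * C2) = bilin_gradient a b c (C1 + \<kappa> * \<epsilon>, \<kappa> * C2)"
proof -
  let ?Q = "(C1 + \<kappa> * \<epsilon>, \<kappa> * C2)"
  have along: "\<kappa> * fst (G ?Q) - \<eta> * snd (G ?Q) = \<kappa> * fst (bilin_gradient a b c ?Q) - \<eta> * snd (bilin_gradient a b c ?Q)"
    if "\<eta> = 1 \<or> \<eta> = -1" "\<epsilon> \<noteq> \<eta> * \<kappa> * C2" for \<eta>
    using gradient_start_along[OF that(1) _ that(2), of 1] unfolding rib_point_1 T_start
    by (simp add: inner_prod_def mult.commute)
  show ?thesis
  proof (cases "\<bar>C2\<bar> < \<epsilon>")
    case True
    then have "\<epsilon> \<noteq> 1 * \<kappa> * C2" "\<epsilon> \<noteq> -1 * \<kappa> * C2" using kappa by auto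
    from along[OF _ this(1)] along[OF _ this(2)] show ?thesis
      using kappa by (auto simp: prod_eq_iff)
  next
    case False
    then obtain \<eta> where \<eta>: "\<eta> = 1 \<or> \<eta> = -1" and deg: "\<epsilon> = \<eta> * \<kappa> * C2"
      using C2_le kappa that[of 1] that[of "-1"] by force
    have "?Q = (C1 + \<eta> * C2, \<eta> * \<epsilon>)" using \<eta> kappa deg by auto
    then have "fst (G ?Q) = fst (bilin_gradient a b c ?Q)"
      using fst_gradient_rib_end[OF \<eta>] by metis
    moreover have "\<epsilon> \<noteq> - \<eta> * \<kappa> * C2" using deg eps_pos \<eta> kappa by auto
    then have "\<kappa> * fst (G ?Q) + \<eta> * snd (G ?Q) = \<kappa> * fst (bilin_gradient a b c ?Q) + \<eta> * snd (bilin_gradient a b c ?Q)"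
      using along[of "- \<eta>"] \<eta> by auto
    ultimately show ?thesis using \<eta> by (auto simp: prod_eq_iff)
  qed
qed

text \<open>Along the rib both gradients have the same component, the slope. Across the rib both components are affine
  by \<open>gradient_across_rib\<close>, so it suffices that they agree at the two ends. A rib that is a point consists of the starting vertex.\<close>

lemma gradient_start_rib:
  assumes \<eta>: "\<eta> = 1 \<or> \<eta> = -1" and r: "r \<in> {0..1}"
  shows "G (rib_point \<eta> (C1 + \<kappa> * \<epsilon>) r) = bilin_gradient a b c (rib_point \<eta> (C1 + \<kappa> * \<epsilon>) r)"
proof (cases "\<epsilon> = \<eta> * \<kappa> * C2")
  case True
  then have "rib_point \<eta> (C1 + \<kappa> * \<epsilon>) r = (C1 + \<kappa> * \<epsilon>, \<kappa> * C2)"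
    unfolding start_rib_point using \<eta> kappa by (auto simp: algebra_simps)
  then show ?thesis using gradient_start by simp
next
  case False
  let ?x = "rib_point \<eta> (C1 + \<kappa> * \<epsilon>) r"
  have "fst (G ?x) = (1 - r) * f' \<eta> (C1 + \<eta> * C2) + r * fst (G (C1 + \<kappa> * \<epsilon>, \<kappa> * C2))"
    using gradient_across_rib[OF \<eta> start_mem r] unfolding start_abscissa unfolding T_start .
  also have "\<dots> = fst (bilin_gradient a b c ?x)"
    unfolding gradient_start vertex_slope[OF \<eta>, symmetric]
    unfolding start_rib_point by (simp add: bilin_gradient_def algebra_simps)
  finally have "fst (G ?x) = fst (bilin_gradient a b c ?x)" .
  moreover have "\<kappa> * fst (G ?x) - \<eta> * snd (G ?x) = \<kappa> * fst (bilin_gradient a b c ?x) - \<eta> * snd (bilin_gradient a b c ?x)"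
    using gradient_start_along[OF \<eta> r False] by (simp add: inner_prod_def mult.commute)
  ultimately show ?thesis using \<eta> by (auto simp: prod_eq_iff)
qed

lemma rectangle_side_matches:
  assumes x: "x \<in> middle_rectangle \<epsilon> C1 C2" and \<eta>: "\<eta> = 1 \<or> \<eta> = -1"
    and side: "\<kappa> * (fst x - C1) + \<eta> * snd x = \<epsilon> + \<eta> * \<kappa> * C2"
  shows "x \<in> D" and "B x = bilin a b c d x" and "G x = bilin_gradient a b c x"
proof -
  \<comment> \<open>\<open>2 * \<delta>\<close> is the range of \<open>y\<close> along the side; if it vanishes the side is a point and any \<open>r\<close> will do.\<close>
  define \<delta> y where "\<delta> = \<epsilon> - \<eta> * \<kappa> * C2" and "y = \<kappa> * (fst x - C1) - \<eta> * snd x"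
  define r where "r = (if \<delta> = 0 then 0 else (y + \<delta>) / (2 * \<delta>))"
  have y: "\<bar>y\<bar> \<le> \<delta>"
    using x \<eta> kappa unfolding middle_rectangle_eq[OF eps_pos C2_le] y_def \<delta>_def by auto
  then have r: "r \<in> {0..1}" by (auto simp: r_def divide_simps)
  have yr: "y = (2 * r - 1) * \<delta>" using y by (auto simp: r_def field_simps)
  have "rib_point \<eta> (C1 + \<kappa> * \<epsilon>) r = x"
  proof -
    have "fst x = C1 + \<kappa> * ((\<epsilon> + \<eta> * \<kappa> * C2) + (2 * r - 1) * \<delta>) / 2"
      "snd x = \<eta> * ((\<epsilon> + \<eta> * \<kappa> * C2) - (2 * r - 1) * \<delta>) / 2"
      unfolding yr[symmetric] side[symmetric] y_def using \<eta> kappa by auto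
    then show ?thesis
      unfolding \<delta>_def start_rib_point using \<eta> kappa
      by (auto simp: prod_eq_iff field_simps)
  qed
  with rib_point_mem[OF \<eta> start_mem r] start_rib_value[OF \<eta> r] gradient_start_rib[OF \<eta> r]
  show "x \<in> D" "B x = bilin a b c d x" "G x = bilin_gradient a b c x" by simp_all
qed

end

section \<open>The spine of a left herringbone does not start on the axis\<close>

lemma C2_smoothD:
  assumes "C2_smooth f"
  shows "(f has_real_derivative deriv f x) (at x)"
    and "continuous_on UNIV (deriv f)" and "continuous_on UNIV (deriv (deriv f))"
proof -
  have C1: "(\<forall>x. (g has_real_derivative deriv g x) (at x)) \<and> continuous_on UNIV (deriv g)"
    if g: "g C1_differentiable_on UNIV" for g :: "real \<Rightarrow> real"
  proof -
    obtain D where D: "\<And>x. (g has_vector_derivative D x) (at x)" "continuous_on UNIV D"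
      using g unfolding C1_differentiable_on_def by auto
    then have "deriv g x = D x" for x
      by (simp add: DERIV_imp_deriv has_real_derivative_iff_has_vector_derivative)
    then have "deriv g = D" by blast
    with D show ?thesis by (simp add: has_real_derivative_iff_has_vector_derivative)
  qed
  from assms show "(f has_real_derivative deriv f x) (at x)"
    "continuous_on UNIV (deriv f)" "continuous_on UNIV (deriv (deriv f))"
    using C1 unfolding C2_smooth_def by blast+
qed

text \<open>Gronwall's argument in both directions of time: \<open>y\<^sup>2\<close> times a suitable exponential is monotone.\<close>

lemma linear_ode_zero:
  fixes y h :: "real \<Rightarrow> real"
  assumes der: "\<And>t. t \<in> {a..b} \<Longrightarrow> (y has_real_derivative y t * h t) (at t within {a..b})"
    and bound: "\<And>t. t \<in> {a..b} \<Longrightarrow> \<bar>h t\<bar> \<le> K"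
    and s: "s \<in> {a..b}" "y s = 0" and t: "t \<in> {a..b}"
  shows "y t = 0"
proof -
  define E where "E k r = (y r)\<^sup>2 * exp (2 * k * r)" for k r
  have E_cont: "continuous_on {a..b} (E k)" for k
    unfolding E_def using der
    by (intro continuous_intros DERIV_continuous_on) auto
  have E_der: "(E k has_real_derivative 2 * (y r)\<^sup>2 * exp (2 * k * r) * (h r + k)) (at r)"
    if "a < r" "r < b" for k r
  proof -
    have "(y has_real_derivative y r * h r) (at r)"
      using der[of r] that by (simp add: at_within_Icc_at)
    then show ?thesis
      unfolding E_def by (auto intro!: derivative_eq_intros simp: power2_eq_square algebra_simps)
  qed
  have "E K t \<le> 0" if ts: "t \<le> s"
  proof -
    have "E K t \<le> E K s"
    proof (rule DERIV_nonneg_imp_increasing_open[OF ts])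
      fix r assume r: "t < r" "r < s"
      then have "0 \<le> h r + K" using bound[of r] s t by auto
      then have "0 \<le> 2 * (y r)\<^sup>2 * exp (2 * K * r) * (h r + K)" by simp
      then show "\<exists>e. (E K has_real_derivative e) (at r) \<and> 0 \<le> e"
        using E_der[of r K] r s t by auto
    next
      show "continuous_on {t..s} (E K)" using continuous_on_subset[OF E_cont] s t by simp
    qed
    then show ?thesis using s by (simp add: E_def)
  qed
  moreover have "E (- K) t \<le> 0" if st: "s \<le> t"
  proof -
    have "E (- K) t \<le> E (- K) s"
    proof (rule DERIV_nonpos_imp_decreasing_open[OF st])
      fix r assume r: "s < r" "r < t"
      then have "h r + - K \<le> 0" using bound[of r] s t by auto
      then have "2 * (y r)\<^sup>2 * exp (2 * - K * r) * (h r + - K) \<le> 0"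
        by (intro mult_nonneg_nonpos) auto
      then show "\<exists>e. (E (- K) has_real_derivative e) (at r) \<and> e \<le> 0"
        using E_der[of r "- K"] r s t by auto
    next
      show "continuous_on {s..t} (E (- K))" using continuous_on_subset[OF E_cont] s t by simp
    qed
    then show ?thesis using s by (simp add: E_def)
  qed
  ultimately obtain k where "E k t \<le> 0" using linear[of s t] by blast
  then have "(y t)\<^sup>2 \<le> 0" by (simp add: E_def mult_le_0_iff)
  then show ?thesis by simp
qed

text \<open>The axis is invariant under the flow, since the second component of the field is \<open>x\<^sub>2\<close> times a
  continuous function.\<close>

lemma trajectory_left_field_axis:
  assumes smooth: "C2_smooth fp" "C2_smooth fm" and traj: "trajectory (left_field \<epsilon> fp fm) \<Gamma>"
    and w: "w \<in> \<Gamma>" "snd w = 0" and z: "z \<in> \<Gamma>"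
  shows "snd z = 0"
proof -
  obtain \<gamma> a b where der: "\<And>t. t \<in> {a..b} \<Longrightarrow>
      (\<gamma> has_vector_derivative left_field \<epsilon> fp fm (\<gamma> t)) (at t within {a..b})"
    and img: "\<gamma> ` {a..b} = \<Gamma>"
    using traj unfolding trajectory_def by blast
  define h where "h x = deriv fm (fst x - snd x) - deriv fp (fst x + snd x)
      - (\<epsilon> - snd x) * deriv (deriv fm) (fst x - snd x)
      + (\<epsilon> + snd x) * deriv (deriv fp) (fst x + snd x)" for x
  have field: "snd (left_field \<epsilon> fp fm x) = snd x * h x" for x
    by (simp add: left_field_def h_def case_prod_beta algebra_simps)
  have \<gamma>_cont: "continuous_on {a..b} \<gamma>"
    using der by (rule continuous_on_vector_derivative)
  have h_cont: "continuous_on UNIV h"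
    unfolding h_def
    by (intro continuous_intros continuous_on_compose2[OF C2_smoothD(2)[OF smooth(1)]]
        continuous_on_compose2[OF C2_smoothD(2)[OF smooth(2)]]
        continuous_on_compose2[OF C2_smoothD(3)[OF smooth(1)]]
        continuous_on_compose2[OF C2_smoothD(3)[OF smooth(2)]]) auto
  have "continuous_on {a..b} (\<lambda>t. h (\<gamma> t))"
    by (rule continuous_on_compose2[OF h_cont \<gamma>_cont]) simp
  then have "bounded ((\<lambda>t. h (\<gamma> t)) ` {a..b})"
    by (intro compact_imp_bounded compact_continuous_image) auto
  then obtain K where "\<forall>v\<in>(\<lambda>t. h (\<gamma> t)) ` {a..b}. norm v \<le> K"
    unfolding bounded_iff by blast
  then have K: "\<bar>h (\<gamma> t)\<bar> \<le> K" if "t \<in> {a..b}" for t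
    using that by simp
  have der2: "((\<lambda>t. snd (\<gamma> t)) has_real_derivative snd (\<gamma> t) * h (\<gamma> t)) (at t within {a..b})"
    if "t \<in> {a..b}" for t
    using bounded_linear.has_vector_derivative[OF bounded_linear_snd der[OF that]]
    by (simp add: has_real_derivative_iff_has_vector_derivative field)
  obtain s t where s: "s \<in> {a..b}" "w = \<gamma> s" and t: "t \<in> {a..b}" "z = \<gamma> t" using w z img by blast
  show ?thesis
    using linear_ode_zero[OF der2 K s(1) _ t(1)] w(2) unfolding s(2) t(2) by blast
qed

text \<open>If the spine started on the axis, it would stay on it up to the first exceptional equilibrium. But the
  spine values are prescribed on the axis only as limits along spine points off the axis.\<close>

lemma left_herringbone_start_off_axis:
  assumes smooth: "C2_smooth fp" "C2_smooth fm"
    and hb: "left_herringbone \<epsilon> fp fm P Q T B"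
  shows "snd P \<noteq> 0"
proof
  assume P0: "snd P = 0"
  define p q where "p = fst P" and "q = fst Q"
  have sp: "spine \<epsilon> T p q" and TP: "T p = snd P"
    and curve: "integral_curve_from (left_field \<epsilon> fp fm) (\<lambda>u. (u - \<epsilon>, T u)) p q p"
    and cand: "herringbone_candidate \<epsilon> fp fm T (left_top \<epsilon> T) (left_bot \<epsilon> T) (left_spine_value \<epsilon> fp fm) p q B"
    using hb unfolding left_herringbone_def p_def q_def by simp_all
  have pq: "p < q" using sp by (simp add: spine_def)
  have Tp: "T p = 0" using TP P0 by simp
  have "\<forall>u\<in>{p..q}. T u = 0 \<longrightarrow> u islimpt {v \<in> {p..q}. T v \<noteq> 0}"
    using cand unfolding herringbone_candidate_def Let_def by blast
  then have lim: "p islimpt {v \<in> {p..q}. T v \<noteq> 0}"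
    using pq Tp by simp
  from curve obtain S where S: "finite S" "p \<notin> S" and traj: "\<forall>a b. p \<le> a \<and> a \<le> b \<and> b \<le> q \<and>
      {a..b} \<inter> S = {} \<longrightarrow> trajectory (left_field \<epsilon> fp fm) ((\<lambda>u. (u - \<epsilon>, T u)) ` {a..b})"
    unfolding integral_curve_from_def by (elim exE conjE)
  obtain \<delta> where \<delta>: "\<delta> > 0" "\<And>u. u \<in> S \<Longrightarrow> \<delta> \<le> dist p u"
    using finite_set_avoid[OF S(1), of p] S(2) by metis
  define r where "r = min q (p + \<delta> / 2)"
  have r: "p < r" "r \<le> q" using pq \<delta> by (auto simp: r_def)
  have "{p..r} \<inter> S = {}"
  proof -
    have "u \<notin> S" if "u \<in> {p..r}" for u
    proof
      assume "u \<in> S"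
      from \<delta>(2)[OF this] that \<delta>(1) show False by (simp add: r_def dist_real_def)
    qed
    then show ?thesis by blast
  qed
  then have tr: "trajectory (left_field \<epsilon> fp fm) ((\<lambda>u. (u - \<epsilon>, T u)) ` {p..r})"
    using traj r by simp
  have axis: "T u = 0" if "u \<in> {p..r}" for u
  proof -
    have "(p - \<epsilon>, T p) \<in> (\<lambda>u. (u - \<epsilon>, T u)) ` {p..r}" using r by simp
    moreover have "(u - \<epsilon>, T u) \<in> (\<lambda>u. (u - \<epsilon>, T u)) ` {p..r}" using that by blast
    ultimately show ?thesis
      using trajectory_left_field_axis[OF smooth tr, of "(p - \<epsilon>, T p)" "(u - \<epsilon>, T u)"] Tp by simp
  qed
  obtain v where "v \<in> {p..q}" "T v \<noteq> 0" "v \<noteq> p" "dist v p < r - p"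
    using lim[unfolded islimpt_approachable, rule_format, of "r - p"] r(1) by auto
  then show False using axis[of v] by (auto simp: dist_real_def)
qed

section \<open>Diagonal concavity across the rectangle\<close>

lemma diag_concave_on_cong:
  assumes "diag_concave_on S f" and "\<And>x. x \<in> S \<Longrightarrow> f x = g x"
  shows "diag_concave_on S g"
  unfolding diag_concave_on_def
proof (intro allI impI)
  fix x y assume xy: "closed_segment x y \<subseteq> S \<and> (\<exists>t. y - x = t *\<^sub>R (1, 1) \<or> y - x = t *\<^sub>R (1, -1))"
  then have "concave_on (closed_segment x y) f"
    using assms(1) unfolding diag_concave_on_def by blast
  then show "concave_on (closed_segment x y) g"
    by (rule concave_on_cong_fun) (use xy assms(2) in blast)
qed

lemma bilin_line:
  assumes "\<sigma> = 1 \<or> \<sigma> = -1"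
  shows "bilin a b c d (x + t *\<^sub>R (1, \<sigma>)) =
    bilin a b c d x + t * (2 * a * (fst x - \<sigma> * snd x) + b + \<sigma> * c)"
  using assms by (auto simp: bilin_def power2_eq_square algebra_simps)

text \<open>Reversing a segment allows one to consider nonnegative parameters only.\<close>

lemma diag_concave_onI_lines:
  assumes "\<And>x t \<sigma>. \<sigma> = 1 \<or> \<sigma> = -1 \<Longrightarrow> 0 \<le> t \<Longrightarrow> (\<And>r. r \<in> {0..t} \<Longrightarrow> x + r *\<^sub>R (1, \<sigma>) \<in> S) \<Longrightarrow>
      concave_on {0..t} (\<lambda>r. B (x + r *\<^sub>R (1, \<sigma>)))"
  shows "diag_concave_on S B"
proof -
  have main: "concave_on (closed_segment x y) B"
    if sub: "closed_segment x y \<subseteq> S" and \<sigma>: "\<sigma> = 1 \<or> \<sigma> = -1" and t: "0 \<le> t" and y: "y - x = t *\<^sub>R (1, \<sigma>)"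
    for x y :: "real \<times> real" and t \<sigma> :: real
  proof -
    have y': "y = x + t *\<^sub>R (1, \<sigma>)" using y by (metis add.commute diff_add_cancel)
    have seg: "closed_segment x y = closed_segment (x + 0 *\<^sub>R (1, \<sigma>)) (x + t *\<^sub>R (1, \<sigma>))"
      by (simp only: y' scaleR_zero_left add_0_right)
    have "x + r *\<^sub>R (1, \<sigma>) \<in> S" if "r \<in> {0..t}" for r
      using sub that unfolding seg closed_segment_line[OF t] by blast
    from assms[OF \<sigma> t this] show ?thesis
      unfolding seg concave_on_segment_iff_line[OF t] .
  qed
  show ?thesis
    unfolding diag_concave_on_def
  proof (intro allI impI)
    fix x y assume xy: "closed_segment x y \<subseteq> S \<and> (\<exists>t. y - x = t *\<^sub>R (1, 1) \<or> y - x = t *\<^sub>R (1, -1))"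
    then obtain t \<sigma> where \<sigma>: "\<sigma> = 1 \<or> \<sigma> = -1" and y: "y - x = t *\<^sub>R (1, \<sigma>)" by blast
    show "concave_on (closed_segment x y) B"
    proof (cases "0 \<le> t")
      case True
      then show ?thesis using main[OF _ \<sigma> _ y] xy by blast
    next
      case False
      have "x - y = (- t) *\<^sub>R (1, \<sigma>)" using y by (metis minus_diff_eq scaleR_minus_left)
      then show ?thesis using main[OF _ \<sigma>, of y x "- t"] xy False by (simp add: closed_segment_commute)
    qed
  qed
qed

lemma diag_concave_on_bilin: "diag_concave_on S (bilin a b c d)"
proof (rule diag_concave_onI_lines)
  fix x :: "real \<times> real" and t \<sigma> :: real
  assume \<sigma>: "\<sigma> = 1 \<or> \<sigma> = -1"
  have "u * (k + m * e) + v * (k + n * e) = k + (u * m + v * n) * e"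
    if "u + v = 1" for u v m n k e :: real
    using that by algebra
  then show "concave_on {0..t} (\<lambda>r. bilin a b c d (x + r *\<^sub>R (1, \<sigma>)))"
    unfolding bilin_line[OF \<sigma>] concave_on_iff by simp
qed

text \<open>The three sets are described by the diagonal coordinates relative to the rectangle: \<open>L\<close> lies beyond one
  of its right sides, \<open>R\<close> beyond one of its left sides. A diagonal line that misses the open rectangle
  stays in \<open>L\<close> or in \<open>R\<close>, because the vertices on the boundary of the strip leave no room for the other herringbone. Any other
  diagonal line crosses the rectangle, and its parts before, in and after the rectangle lie in \<open>R\<close>, \<open>M\<close>
  and \<open>L\<close> respectively, so that the three concave pieces can be joined.\<close>

lemma diag_concave_on_glued:
  assumes M: "M = {x. \<bar>fst x - C1 + snd x\<bar> \<le> \<epsilon> + C2 \<and> \<bar>fst x - C1 - snd x\<bar> \<le> \<epsilon> - C2}"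
    and C2: "\<bar>C2\<bar> \<le> \<epsilon>"
    and strip: "L \<union> R \<subseteq> strip \<epsilon>"
    and L: "\<And>x. x \<in> L \<Longrightarrow> \<exists>\<eta>. (\<eta> = 1 \<or> \<eta> = -1) \<and> \<epsilon> + \<eta> * C2 \<le> fst x - C1 + \<eta> * snd x"
    and R: "\<And>x. x \<in> R \<Longrightarrow> \<exists>\<eta>. (\<eta> = 1 \<or> \<eta> = -1) \<and> fst x - C1 + \<eta> * snd x \<le> - (\<epsilon> + \<eta> * C2)"
    and LM: "\<And>x \<eta>. x \<in> M \<Longrightarrow> \<eta> = 1 \<or> \<eta> = -1 \<Longrightarrow> fst x - C1 + \<eta> * snd x = \<epsilon> + \<eta> * C2 \<Longrightarrow> x \<in> L"
    and RM: "\<And>x \<eta>. x \<in> M \<Longrightarrow> \<eta> = 1 \<or> \<eta> = -1 \<Longrightarrow> fst x - C1 + \<eta> * snd x = - (\<epsilon> + \<eta> * C2) \<Longrightarrow> x \<in> R"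
    and conc: "diag_concave_on L F" "diag_concave_on M F" "diag_concave_on R F"
    and grad: "has_gradient_on F H (L \<union> M \<union> R)"
  shows "diag_concave_on (L \<union> M \<union> R) F"
proof (rule diag_concave_onI_lines)
  fix x :: "real \<times> real" and t \<sigma> :: real
  assume \<sigma>: "\<sigma> = 1 \<or> \<sigma> = -1" and t: "0 \<le> t" and sub: "\<And>r. r \<in> {0..t} \<Longrightarrow> x + r *\<^sub>R (1, \<sigma>) \<in> L \<union> M \<union> R"
  define s w where "s = (\<lambda>z :: real \<times> real. fst z - C1 + \<sigma> * snd z)"
    and "w = (\<lambda>z :: real \<times> real. fst z - C1 - \<sigma> * snd z)"
  define \<rho> \<rho>' where "\<rho> = \<epsilon> + \<sigma> * C2" and "\<rho>' = \<epsilon> - \<sigma> * C2"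
  have \<rho>: "0 \<le> \<rho>" "0 \<le> \<rho>'" using C2 \<sigma> by (auto simp: \<rho>_def \<rho>'_def)
  have M': "z \<in> M \<longleftrightarrow> \<bar>s z\<bar> \<le> \<rho> \<and> \<bar>w z\<bar> \<le> \<rho>'" for z
    using \<sigma> by (auto simp: M s_def w_def \<rho>_def \<rho>'_def)
  have L': "\<rho> \<le> s z \<or> \<rho>' \<le> w z" if "z \<in> L" for z
    using L[OF that] \<sigma> by (auto simp: s_def w_def \<rho>_def \<rho>'_def)
  have R': "s z \<le> - \<rho> \<or> w z \<le> - \<rho>'" if "z \<in> R" for z
    using R[OF that] \<sigma> by (auto simp: s_def w_def \<rho>_def \<rho>'_def)
  have LM': "z \<in> L" if "z \<in> M" "s z = \<rho> \<or> w z = \<rho>'" for z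
    using LM[OF that(1), of \<sigma>] LM[OF that(1), of "- \<sigma>"] that(2) \<sigma>
    by (auto simp: s_def w_def \<rho>_def \<rho>'_def)
  have RM': "z \<in> R" if "z \<in> M" "s z = - \<rho> \<or> w z = - \<rho>'" for z
    using RM[OF that(1), of \<sigma>] RM[OF that(1), of "- \<sigma>"] that(2) \<sigma>
    by (auto simp: s_def w_def \<rho>_def \<rho>'_def)
  have strip': "\<bar>s z - w z\<bar> \<le> \<rho> + \<rho>'" if "z \<in> L \<union> R" for z
    using strip that \<sigma> by (fastforce simp: s_def w_def \<rho>_def \<rho>'_def strip_def)
  have far_right: "z \<in> L" if "z \<in> L \<union> M \<union> R" "\<rho>' \<le> w z" for z
  proof (rule ccontr)
    assume "z \<notin> L"
    then have "z \<in> M \<or> z \<in> R" using that by blast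
    moreover have "z \<in> M" if "z \<in> R"
      using R'[OF that] strip'[of z] that \<open>\<rho>' \<le> w z\<close> \<rho> unfolding M' by force
    ultimately have "z \<in> M" by blast
    then show False using LM'[of z] M'[of z] \<open>z \<notin> L\<close> that(2) by force
  qed
  have far_left: "z \<in> R" if "z \<in> L \<union> M \<union> R" "w z \<le> - \<rho>'" for z
  proof (rule ccontr)
    assume "z \<notin> R"
    then have "z \<in> M \<or> z \<in> L" using that by blast
    moreover have "z \<in> M" if "z \<in> L"
      using L'[OF that] strip'[of z] that \<open>w z \<le> - \<rho>'\<close> \<rho> unfolding M' by force
    ultimately have "z \<in> M" by blast
    then show False using RM'[of z] M'[of z] \<open>z \<notin> R\<close> that(2) by force
  qed
  have between: "(\<rho> \<le> s z \<longrightarrow> z \<in> L) \<and> (\<bar>s z\<bar> \<le> \<rho> \<longrightarrow> z \<in> M) \<and> (s z \<le> - \<rho> \<longrightarrow> z \<in> R)"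
    if z: "z \<in> L \<union> M \<union> R" "\<bar>w z\<bar> < \<rho>'" for z
  proof -
    have mid: "z \<in> M" if "\<bar>s z\<bar> \<le> \<rho>" using z(2) that unfolding M' by simp
    have "z \<in> L" if "\<rho> \<le> s z"
    proof (rule ccontr)
      assume "z \<notin> L"
      moreover have "s z \<noteq> \<rho>" using LM'[of z] mid \<rho> \<open>z \<notin> L\<close> by auto
      ultimately show False using z R'[of z] M'[of z] that \<rho> by force
    qed
    moreover have "z \<in> R" if "s z \<le> - \<rho>"
    proof (rule ccontr)
      assume "z \<notin> R"
      moreover have "s z \<noteq> - \<rho>" using RM'[of z] mid \<rho> \<open>z \<notin> R\<close> by auto
      ultimately show False using z L'[of z] M'[of z] that \<rho> by force
    qed
    ultimately show ?thesis using mid by blast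
  qed
  have s_line: "s (x + r *\<^sub>R (1, \<sigma>)) = s x + 2 * r" and w_line: "w (x + r *\<^sub>R (1, \<sigma>)) = w x" for r
    using \<sigma> by (auto simp: s_def w_def algebra_simps)
  let ?\<phi> = "\<lambda>r. F (x + r *\<^sub>R (1, \<sigma>))"
  consider "\<rho>' \<le> w x" | "w x \<le> - \<rho>'" | "\<bar>w x\<bar> < \<rho>'" by linarith
  then show "concave_on {0..t} ?\<phi>"
  proof cases
    case 1
    then show ?thesis
      by (intro diag_concave_on_line[OF conc(1) \<sigma>] far_right sub) (simp_all only: w_line)
  next
    case 2
    then show ?thesis
      by (intro diag_concave_on_line[OF conc(3) \<sigma>] far_left sub) (simp_all only: w_line)
  next
    case 3
    have der: "\<exists>e. (?\<phi> has_real_derivative e) (at r within {l..t})" if "0 \<le> l" "r \<in> {l..t}" for r l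
    proof -
      have "((\<lambda>r. x + r *\<^sub>R (1, \<sigma>)) has_vector_derivative (1, \<sigma>)) (at r within {l..t})"
        by (auto intro!: derivative_eq_intros)
      moreover have "(\<lambda>r. x + r *\<^sub>R (1, \<sigma>)) ` {l..t} \<subseteq> L \<union> M \<union> R"
        by (intro image_subsetI sub) (use that(1) in simp)
      ultimately show ?thesis
        using has_gradient_on_curve[OF grad _ _ that(2)] by blast
    qed
    \<comment> \<open>The parameters at which the line enters and leaves the rectangle, possibly outside \<open>[0, t]\<close>.\<close>
    define m n where "m = (- \<rho> - s x) / 2" and "n = (\<rho> - s x) / 2"
    have cut: "(m \<le> r \<longleftrightarrow> - \<rho> \<le> s x + 2 * r) \<and> (r \<le> m \<longleftrightarrow> s x + 2 * r \<le> - \<rho>) \<and>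
        (n \<le> r \<longleftrightarrow> \<rho> \<le> s x + 2 * r) \<and> (r \<le> n \<longleftrightarrow> s x + 2 * r \<le> \<rho>)" for r
      unfolding m_def n_def by (auto simp: field_simps)
    have piece: "concave_on {l..k} ?\<phi>" if "0 \<le> l" "k \<le> t" and
      "(\<forall>r\<in>{l..k}. s x + 2 * r \<le> - \<rho>) \<or> (\<forall>r\<in>{l..k}. \<bar>s x + 2 * r\<bar> \<le> \<rho>) \<or> (\<forall>r\<in>{l..k}. \<rho> \<le> s x + 2 * r)" for l k
    proof -
      have r: "r \<in> {0..t}" if "r \<in> {l..k}" for r using that \<open>0 \<le> l\<close> \<open>k \<le> t\<close> by auto
      have *: "(\<rho> \<le> s x + 2 * r \<longrightarrow> x + r *\<^sub>R (1, \<sigma>) \<in> L) \<and> (\<bar>s x + 2 * r\<bar> \<le> \<rho> \<longrightarrow> x + r *\<^sub>R (1, \<sigma>) \<in> M) \<and>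
          (s x + 2 * r \<le> - \<rho> \<longrightarrow> x + r *\<^sub>R (1, \<sigma>) \<in> R)" if "r \<in> {l..k}" for r
        using between[OF sub[OF r[OF that]]] 3 unfolding s_line w_line by blast
      from that(3) show ?thesis
      proof (elim disjE)
        assume "\<forall>r\<in>{l..k}. s x + 2 * r \<le> - \<rho>"
        then show ?thesis by (intro diag_concave_on_line[OF conc(3) \<sigma>]) (use * in blast)
      next
        assume "\<forall>r\<in>{l..k}. \<bar>s x + 2 * r\<bar> \<le> \<rho>"
        then show ?thesis by (intro diag_concave_on_line[OF conc(2) \<sigma>]) (use * in blast)
      next
        assume "\<forall>r\<in>{l..k}. \<rho> \<le> s x + 2 * r"
        then show ?thesis by (intro diag_concave_on_line[OF conc(1) \<sigma>]) (use * in blast)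
      qed
    qed
    have ivl: "{k..t} \<inter> {..r} = {k..min r t}" "{k..t} \<inter> {r..} = {max k r..t}" for k r by auto
    have on_R: "concave_on ({0..t} \<inter> {..m}) ?\<phi>"
      unfolding ivl
    proof (rule piece)
      have "s x + 2 * r \<le> - \<rho>" if "r \<in> {0..min m t}" for r using cut[of r] that by simp
      then show "(\<forall>r\<in>{0..min m t}. s x + 2 * r \<le> - \<rho>) \<or> (\<forall>r\<in>{0..min m t}. \<bar>s x + 2 * r\<bar> \<le> \<rho>) \<or>
          (\<forall>r\<in>{0..min m t}. \<rho> \<le> s x + 2 * r)" by blast
    qed simp_all
    have on_M: "concave_on ({max 0 m..t} \<inter> {..n}) ?\<phi>"
      unfolding ivl
    proof (rule piece)
      have "\<bar>s x + 2 * r\<bar> \<le> \<rho>" if "r \<in> {max 0 m..min n t}" for r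
        using cut[of r] that by (simp add: abs_le_iff)
      then show "(\<forall>r\<in>{max 0 m..min n t}. s x + 2 * r \<le> - \<rho>) \<or>
          (\<forall>r\<in>{max 0 m..min n t}. \<bar>s x + 2 * r\<bar> \<le> \<rho>) \<or>
          (\<forall>r\<in>{max 0 m..min n t}. \<rho> \<le> s x + 2 * r)" by blast
    qed simp_all
    have on_L: "concave_on ({max 0 m..t} \<inter> {n..}) ?\<phi>"
      unfolding ivl
    proof (rule piece)
      have "\<rho> \<le> s x + 2 * r" if "r \<in> {max (max 0 m) n..t}" for r using cut[of r] that by simp
      then show "(\<forall>r\<in>{max (max 0 m) n..t}. s x + 2 * r \<le> - \<rho>) \<or>
          (\<forall>r\<in>{max (max 0 m) n..t}. \<bar>s x + 2 * r\<bar> \<le> \<rho>) \<or>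
          (\<forall>r\<in>{max (max 0 m) n..t}. \<rho> \<le> s x + 2 * r)" by blast
    qed simp_all
    have "concave_on {max 0 m..t} ?\<phi>"
      by (rule concave_on_join[OF on_M on_L]) (rule der, simp)
    then have "concave_on ({0..t} \<inter> {m..}) ?\<phi>" unfolding ivl .
    with on_R show ?thesis
      by (rule concave_on_join) (rule der, simp)
  qed
qed

section \<open>Gluing the herringbones to the rectangle\<close>

lemma herringbone_at_rectangle_left:
  assumes eps: "0 < \<epsilon>" and smooth: "C2_smooth fp" "C2_smooth fm" and C2: "\<bar>C2\<bar> \<le> \<epsilon>" "C2 \<noteq> 0"
    and Q: "Q \<in> strip \<epsilon>" and hb: "left_herringbone \<epsilon> fp fm (C1 + \<epsilon>, C2) Q T B"
    and vertex: "bilin a b c d (C1 + C2, \<epsilon>) = fp (C1 + C2)" "bilin a b c d (C1 - C2, -\<epsilon>) = fm (C1 - C2)"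
      "2 * a * (C1 + C2) + b = deriv fp (C1 + C2)" "2 * a * (C1 - C2) + b = deriv fm (C1 - C2)"
    and grad: "has_gradient_on B G (left_domain \<epsilon> T (C1 + \<epsilon>) (fst Q))"
  shows "herringbone_at_rectangle \<epsilon> 1 C1 C2 (C1 + \<epsilon>) (fst Q) a b c d T
    (\<lambda>\<eta>. if \<eta> = 1 then fp else fm) (\<lambda>\<eta>. if \<eta> = 1 then deriv fp else deriv fm)
    B G (left_domain \<epsilon> T (C1 + \<epsilon>) (fst Q))"
proof -
  let ?p = "C1 + \<epsilon>" and ?q = "fst Q" and ?D = "left_domain \<epsilon> T (C1 + \<epsilon>) (fst Q)"
  have ends: "left_top \<epsilon> T = rib_end \<epsilon> T 1 1" "left_bot \<epsilon> T = rib_end \<epsilon> T 1 (-1)"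
    by (auto simp: left_top_def left_bot_def rib_end_def)
  have sp: "spine \<epsilon> T ?p ?q" and T: "T ?p = C2" "T ?q = snd Q"
    and cand: "herringbone_candidate \<epsilon> fp fm T (left_top \<epsilon> T) (left_bot \<epsilon> T) (left_spine_value \<epsilon> fp fm) ?p ?q B"
    using hb by (simp_all add: left_herringbone_def)
  have pq: "?p < ?q" using sp by (simp add: spine_def)
  have cand': "(\<forall>x. (x, \<epsilon>) \<in> ?D \<longrightarrow> B (x, \<epsilon>) = fp x)" "(\<forall>x. (x, -\<epsilon>) \<in> ?D \<longrightarrow> B (x, -\<epsilon>) = fm x)"
    "\<forall>u\<in>{?p..?q}. affine_on_segment (u, T u) (left_top \<epsilon> T u) B \<and> affine_on_segment (u, T u) (left_bot \<epsilon> T u) B"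
    "\<forall>u\<in>{?p..?q}. T u \<noteq> 0 \<longrightarrow> B (u, T u) = left_spine_value \<epsilon> fp fm u (T u)"
    using cand unfolding herringbone_candidate_def Let_def left_domain_def by blast+
  have start: "B (C1 + \<epsilon>, C2) = left_spine_value \<epsilon> fp fm (C1 + \<epsilon>) C2"
    using cand'(4)[rule_format, of "C1 + \<epsilon>"] pq T(1) C2(2) by simp
  have abscissae: "C1 + \<epsilon> + C2 - \<epsilon> = C1 + C2" "C1 + \<epsilon> - C2 - \<epsilon> = C1 - C2" by simp_all
  show ?thesis
  proof
    show "\<bar>T u\<bar> \<le> \<epsilon>" if "u \<in> {?p..?q}" for u
      using that T C2 Q spine_derivative(3)[OF sp, of u]
      by (cases "u = ?p \<or> u = ?q") (auto simp: strip_def)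
    show "?D = herringbone_domain T (rib_end \<epsilon> T 1 1) (rib_end \<epsilon> T 1 (-1)) ?p ?q"
      by (simp add: left_domain_def ends)
    show "affine_on_segment (u, T u) (rib_end \<epsilon> T 1 \<eta> u) B" if "\<eta> = 1 \<or> \<eta> = -1" "u \<in> {?p..?q}" for \<eta> u
      using cand'(3) that by (auto simp: ends)
    show "B (C1 + 1 * \<epsilon>, 1 * C2) = (\<epsilon>\<^sup>2 - C2\<^sup>2) / (2 * \<epsilon> * C2)
          * ((\<epsilon> + 1 * C2) * (if (1::real) = 1 then deriv fp else deriv fm) (C1 + C2)
            - (\<epsilon> - 1 * C2) * (if (-1::real) = 1 then deriv fp else deriv fm) (C1 - C2))
        + ((\<epsilon> + 1 * C2) * (if (1::real) = 1 then fp else fm) (C1 + C2)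
          + (\<epsilon> - 1 * C2) * (if (-1::real) = 1 then fp else fm) (C1 - C2)) / (2 * \<epsilon>)"
      using start unfolding left_spine_value_def abscissae by simp
  qed (use eps C2 sp grad T pq cand'(1,2) vertex C2_smoothD[OF smooth(1)] C2_smoothD[OF smooth(2)] in auto)
qed

lemma herringbone_at_rectangle_right:
  assumes eps: "0 < \<epsilon>" and smooth: "C2_smooth fp" "C2_smooth fm" and C2: "\<bar>C2\<bar> \<le> \<epsilon>" "C2 \<noteq> 0"
    and Q: "Q \<in> strip \<epsilon>" and hb: "right_herringbone \<epsilon> fp fm (C1 - \<epsilon>, -C2) Q T B"
    and vertex: "bilin a b c d (C1 + C2, \<epsilon>) = fp (C1 + C2)" "bilin a b c d (C1 - C2, -\<epsilon>) = fm (C1 - C2)"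
      "2 * a * (C1 + C2) + b = deriv fp (C1 + C2)" "2 * a * (C1 - C2) + b = deriv fm (C1 - C2)"
    and grad: "has_gradient_on B G (right_domain \<epsilon> T (fst Q) (C1 - \<epsilon>))"
  shows "herringbone_at_rectangle \<epsilon> (-1) C1 C2 (fst Q) (C1 - \<epsilon>) a b c d T
    (\<lambda>\<eta>. if \<eta> = 1 then fp else fm) (\<lambda>\<eta>. if \<eta> = 1 then deriv fp else deriv fm)
    B G (right_domain \<epsilon> T (fst Q) (C1 - \<epsilon>))"
proof -
  let ?p = "fst Q" and ?q = "C1 - \<epsilon>" and ?D = "right_domain \<epsilon> T (fst Q) (C1 - \<epsilon>)"
  have ends: "right_top \<epsilon> T = rib_end \<epsilon> T (-1) 1" "right_bot \<epsilon> T = rib_end \<epsilon> T (-1) (-1)"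
    by (auto simp: right_top_def right_bot_def rib_end_def)
  have sp: "spine \<epsilon> T ?p ?q" and T: "T ?q = - C2" "T ?p = snd Q"
    and cand: "herringbone_candidate \<epsilon> fp fm T (right_top \<epsilon> T) (right_bot \<epsilon> T) (right_spine_value \<epsilon> fp fm) ?p ?q B"
    using hb by (simp_all add: right_herringbone_def)
  have pq: "?p < ?q" using sp by (simp add: spine_def)
  have cand': "(\<forall>x. (x, \<epsilon>) \<in> ?D \<longrightarrow> B (x, \<epsilon>) = fp x)" "(\<forall>x. (x, -\<epsilon>) \<in> ?D \<longrightarrow> B (x, -\<epsilon>) = fm x)"
    "\<forall>u\<in>{?p..?q}. affine_on_segment (u, T u) (right_top \<epsilon> T u) B \<and> affine_on_segment (u, T u) (right_bot \<epsilon> T u) B"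
    "\<forall>u\<in>{?p..?q}. T u \<noteq> 0 \<longrightarrow> B (u, T u) = right_spine_value \<epsilon> fp fm u (T u)"
    using cand unfolding herringbone_candidate_def Let_def right_domain_def by blast+
  have start: "B (C1 - \<epsilon>, -C2) = right_spine_value \<epsilon> fp fm (C1 - \<epsilon>) (-C2)"
    using cand'(4)[rule_format, of "C1 - \<epsilon>"] pq T(1) C2(2) by simp
  have abscissae: "C1 - \<epsilon> - - C2 + \<epsilon> = C1 + C2" "C1 - \<epsilon> + - C2 + \<epsilon> = C1 - C2" by simp_all
  show ?thesis
  proof
    show "\<bar>T u\<bar> \<le> \<epsilon>" if "u \<in> {?p..?q}" for u
      using that T C2 Q spine_derivative(3)[OF sp, of u]
      by (cases "u = ?p \<or> u = ?q") (auto simp: strip_def)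
    show "?D = herringbone_domain T (rib_end \<epsilon> T (-1) 1) (rib_end \<epsilon> T (-1) (-1)) ?p ?q"
      by (simp add: right_domain_def ends)
    show "affine_on_segment (u, T u) (rib_end \<epsilon> T (-1) \<eta> u) B" if "\<eta> = 1 \<or> \<eta> = -1" "u \<in> {?p..?q}" for \<eta> u
      using cand'(3) that by (auto simp: ends)
    show "B (C1 + -1 * \<epsilon>, -1 * C2) = (\<epsilon>\<^sup>2 - C2\<^sup>2) / (2 * \<epsilon> * C2)
          * ((\<epsilon> + -1 * C2) * (if (1::real) = 1 then deriv fp else deriv fm) (C1 + C2)
            - (\<epsilon> - -1 * C2) * (if (-1::real) = 1 then deriv fp else deriv fm) (C1 - C2))
        + ((\<epsilon> + -1 * C2) * (if (1::real) = 1 then fp else fm) (C1 + C2)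
          + (\<epsilon> - -1 * C2) * (if (-1::real) = 1 then fp else fm) (C1 - C2)) / (2 * \<epsilon>)"
    proof -
      have flip: "(\<epsilon>\<^sup>2 - (- C2)\<^sup>2) / (2 * \<epsilon> * - C2) * ((\<epsilon> - - C2) * X - (\<epsilon> + - C2) * Y)
          = (\<epsilon>\<^sup>2 - C2\<^sup>2) / (2 * \<epsilon> * C2) * ((\<epsilon> + -1 * C2) * Y - (\<epsilon> - -1 * C2) * X)" for X Y
        using eps C2(2) by (simp add: field_simps)
      show ?thesis
        using start unfolding right_spine_value_def abscissae flip by simp
    qed
  qed (use eps C2 sp grad T pq cand'(1,2) vertex C2_smoothD[OF smooth(1)] C2_smoothD[OF smooth(2)] in auto)
qed

theorem proposition11p1:
  fixes \<epsilon> C1 C2 :: real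
    and fp fm Tl Tr :: "real \<Rightarrow> real"
    and Cr Cl :: "real \<times> real"
    and Bl Br :: "real \<times> real \<Rightarrow> real"
  assumes "\<epsilon> > 0"
    and "C2_smooth fp" and "C2_smooth fm"
    and "(C1, C2) \<in> strip \<epsilon>"
    and "Cr \<in> strip \<epsilon>" and "fst Cr > C1 + \<epsilon>"
    and "Cl \<in> strip \<epsilon>" and "fst Cl < C1 - \<epsilon>"
    and "left_herringbone \<epsilon> fp fm (C1 + \<epsilon>, C2) Cr Tl Bl"
    and "right_herringbone \<epsilon> fp fm (C1 - \<epsilon>, -C2) Cl Tr Br"
  shows "let L = left_domain \<epsilon> Tl (C1 + \<epsilon>) (fst Cr);
             R = right_domain \<epsilon> Tr (fst Cl) (C1 - \<epsilon>);
             M = middle_rectangle \<epsilon> C1 C2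
         in \<exists>g. rectangle_function \<epsilon> fp fm C1 C2 Bl Br g \<and>
              (\<forall>g'. rectangle_function \<epsilon> fp fm C1 C2 Bl Br g' \<longrightarrow> (\<forall>x\<in>M. g' x = g x)) \<and>
              (\<exists>F. (\<forall>x\<in>L. F x = Bl x) \<and> (\<forall>x\<in>R. F x = Br x) \<and> (\<forall>x\<in>M. F x = g x) \<and>
                   diag_concave_on (L \<union> M \<union> R) F \<and> C1_smooth_on (L \<union> M \<union> R) F)"
proof -
  have eps: "0 < \<epsilon>" and smooth: "C2_smooth fp" "C2_smooth fm" and C2: "\<bar>C2\<bar> \<le> \<epsilon>"
    using assms by (simp_all add: strip_def)
  have C2_nz: "C2 \<noteq> 0"
    using left_herringbone_start_off_axis[OF smooth assms(9)] by simp
  define L R M where "L = left_domain \<epsilon> Tl (C1 + \<epsilon>) (fst Cr)"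
    and "R = right_domain \<epsilon> Tr (fst Cl) (C1 - \<epsilon>)" and "M = middle_rectangle \<epsilon> C1 C2"
  have cand: "C1_smooth_on L Bl" "diag_concave_on L Bl" "C1_smooth_on R Br" "diag_concave_on R Br"
    using assms(9,10)
    by (auto simp: left_herringbone_def right_herringbone_def herringbone_candidate_def Let_def
        L_def R_def left_domain_def right_domain_def)
  obtain Gl Gr where Gl: "has_gradient_on Bl Gl L" and Gr: "has_gradient_on Br Gr R"
    using cand unfolding C1_smooth_on_iff by blast

  \<comment> \<open>\<open>a\<close> and \<open>b\<close> fit the horizontal derivatives at the vertices on the boundary of the strip, \<open>c\<close> and
    \<open>d\<close> the values there.\<close>
  define a where "a = (deriv fp (C1 + C2) - deriv fm (C1 - C2)) / (4 * C2)"
  define b where "b = deriv fp (C1 + C2) - 2 * a * (C1 + C2)"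
  define c where "c = (fp (C1 + C2) - fm (C1 - C2) - 4 * a * C1 * C2 - 2 * b * C2) / (2 * \<epsilon>)"
  define d where "d = fp (C1 + C2) - (a * ((C1 + C2)\<^sup>2 - \<epsilon>\<^sup>2) + b * (C1 + C2) + c * \<epsilon>)"
  let ?g = "bilin a b c d"
  have aC2: "4 * a * C2 = deriv fp (C1 + C2) - deriv fm (C1 - C2)"
    using C2_nz by (simp add: a_def)
  have c\<epsilon>: "2 * c * \<epsilon> = fp (C1 + C2) - fm (C1 - C2) - 4 * a * C1 * C2 - 2 * b * C2"
    using eps by (simp add: c_def)
  have vertex: "?g (C1 + C2, \<epsilon>) = fp (C1 + C2)" "?g (C1 - C2, -\<epsilon>) = fm (C1 - C2)"
      "2 * a * (C1 + C2) + b = deriv fp (C1 + C2)" "2 * a * (C1 - C2) + b = deriv fm (C1 - C2)"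
    using aC2 c\<epsilon> by (simp_all add: bilin_def d_def b_def power2_eq_square algebra_simps)

  interpret Left: herringbone_at_rectangle \<epsilon> 1 C1 C2 "C1 + \<epsilon>" "fst Cr" a b c d Tl
    "\<lambda>\<eta>. if \<eta> = 1 then fp else fm" "\<lambda>\<eta>. if \<eta> = 1 then deriv fp else deriv fm" Bl Gl L
    unfolding L_def
    by (rule herringbone_at_rectangle_left[OF eps smooth C2 C2_nz assms(5) assms(9) vertex Gl[unfolded L_def]])
  interpret Right: herringbone_at_rectangle \<epsilon> "-1" C1 C2 "fst Cl" "C1 - \<epsilon>" a b c d Tr
    "\<lambda>\<eta>. if \<eta> = 1 then fp else fm" "\<lambda>\<eta>. if \<eta> = 1 then deriv fp else deriv fm" Br Gr R
    unfolding R_def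
    by (rule herringbone_at_rectangle_right[OF eps smooth C2 C2_nz assms(7) assms(10) vertex Gr[unfolded R_def]])

  have rect: "rectangle_function \<epsilon> fp fm C1 C2 Bl Br ?g"
    using vertex Left.start_value_bilin Right.start_value_bilin
    unfolding rectangle_function_def bilinear_function_iff_bilin by auto
  have unique: "g' x = ?g x" if "rectangle_function \<epsilon> fp fm C1 C2 Bl Br g'" "x \<in> M" for g' x
    using that rect bilinear_function_rectangle_unique[OF eps C2, of g' ?g C1 x]
    unfolding rectangle_function_def M_def by simp

  have M: "M = {x. \<bar>fst x - C1 + snd x\<bar> \<le> \<epsilon> + C2 \<and> \<bar>fst x - C1 - snd x\<bar> \<le> \<epsilon> - C2}"
    unfolding M_def by (rule middle_rectangle_eq[OF eps C2])
  have closed_M: "closed M"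
    unfolding M_def middle_rectangle_def by (simp add: compact_convex_hull compact_imp_closed)
  have L_side: "\<exists>\<eta>. (\<eta> = 1 \<or> \<eta> = -1) \<and> \<epsilon> + \<eta> * C2 \<le> fst x - C1 + \<eta> * snd x" if "x \<in> L" for x
    using Left.domain_side[OF that] by simp
  have R_side: "\<exists>\<eta>. (\<eta> = 1 \<or> \<eta> = -1) \<and> fst x - C1 + \<eta> * snd x \<le> - (\<epsilon> + \<eta> * C2)" if x: "x \<in> R" for x
  proof -
    obtain \<eta> where "\<eta> = 1 \<or> \<eta> = -1" "\<epsilon> + \<eta> * (-1) * C2 \<le> -1 * (fst x - C1) + \<eta> * snd x"
      using Right.domain_side[OF x] by blast
    then show ?thesis by (intro exI[of _ "- \<eta>"]) auto
  qed
  have LM: "x \<in> L \<and> Bl x = ?g x \<and> Gl x = bilin_gradient a b c x"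
    if "x \<in> M" "\<eta> = 1 \<or> \<eta> = -1" "fst x - C1 + \<eta> * snd x = \<epsilon> + \<eta> * C2" for x \<eta>
    using Left.rectangle_side_matches[of x \<eta>] that unfolding M_def by simp
  have RM: "x \<in> R \<and> Br x = ?g x \<and> Gr x = bilin_gradient a b c x"
    if "x \<in> M" "\<eta> = 1 \<or> \<eta> = -1" "fst x - C1 + \<eta> * snd x = - (\<epsilon> + \<eta> * C2)" for x \<eta>
    using Right.rectangle_side_matches[of x "- \<eta>"] that unfolding M_def by auto
  have L_int_M: "Bl x = ?g x \<and> Gl x = bilin_gradient a b c x" if "x \<in> L" "x \<in> M" for x
    using L_side[OF that(1)] that(2) LM[OF that(2)] unfolding M by force
  have R_int_M: "Br x = ?g x \<and> Gr x = bilin_gradient a b c x" if "x \<in> R" "x \<in> M" for x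
    using R_side[OF that(1)] that(2) RM[OF that(2)] unfolding M by force
  have strip: "L \<union> R \<subseteq> strip \<epsilon>"
    using Left.domain_subset_strip Right.domain_subset_strip by blast
  \<comment> \<open>The herringbones can meet only in vertices of the rectangle, or in the whole rectangle if that is
    a segment.\<close>
  have L_int_R: "x \<in> M" if "x \<in> L" "x \<in> R" for x
    using L_side[OF that(1)] R_side[OF that(2)] strip that C2 unfolding M strip_def by force

  define F where "F x = (if x \<in> L then Bl x else if x \<in> R then Br x else ?g x)" for x
  have grad_RM: "has_gradient_on (\<lambda>x. if x \<in> R then Br x else ?g x)
      (\<lambda>x. if x \<in> R then Gr x else bilin_gradient a b c x) (R \<union> M)"
    using R_int_M by (intro has_gradient_on_Un Gr has_gradient_on_bilin Right.closed_domain closed_M) auto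
  have "has_gradient_on F
      (\<lambda>x. if x \<in> L then Gl x else if x \<in> R then Gr x else bilin_gradient a b c x) (L \<union> (R \<union> M))"
    unfolding F_def
  proof (rule has_gradient_on_Un[OF Gl Left.closed_domain grad_RM])
    show "closed (R \<union> M)" by (intro closed_Un Right.closed_domain closed_M)
  next
    fix x assume "x \<in> L" "x \<in> R \<union> M"
    then show "Bl x = (if x \<in> R then Br x else ?g x) \<and>
        Gl x = (if x \<in> R then Gr x else bilin_gradient a b c x)"
      using L_int_M[of x] L_int_R[of x] R_int_M[of x] by auto
  qed
  then have grad: "has_gradient_on F
      (\<lambda>x. if x \<in> L then Gl x else if x \<in> R then Gr x else bilin_gradient a b c x) (L \<union> M \<union> R)"
    by (simp add: Un_ac)

  have "(x \<in> L \<longrightarrow> F x = Bl x) \<and> (x \<in> R \<longrightarrow> F x = Br x) \<and> (x \<in> M \<longrightarrow> F x = ?g x)" for x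
    using L_int_M[of x] L_int_R[of x] R_int_M[of x] unfolding F_def by auto
  then have F: "\<forall>x\<in>L. F x = Bl x" "\<forall>x\<in>R. F x = Br x" "\<forall>x\<in>M. F x = ?g x"
    by blast+
  have "diag_concave_on L F" "diag_concave_on M F" "diag_concave_on R F"
    using diag_concave_on_cong[OF cand(2), of F] diag_concave_on_cong[OF diag_concave_on_bilin, of M a b c d F]
      diag_concave_on_cong[OF cand(4), of F] F by simp_all
  then have "diag_concave_on (L \<union> M \<union> R) F"
    using LM RM by (intro diag_concave_on_glued[OF M C2 strip L_side R_side _ _ _ _ _ grad]) blast+
  moreover have "C1_smooth_on (L \<union> M \<union> R) F"
    using grad unfolding C1_smooth_on_iff by blast
  ultimately show ?thesis
    unfolding Let_def L_def[symmetric] R_def[symmetric] M_def[symmetric]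
    using rect unique F by blast
qed

end
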